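(* (Checkerboard incircles incidence theorem) Consider a quadrilateral in the plane that is cut by two sets of four lines into $25$ quadrilaterals (combinatorially a $5\times 5$ grid). Color the quadrilaterals in a checkerboard pattern with black quadrilaterals at the corners (so that there are $13$ black quadrilaterals). Assume that all black quadrilaterals except one at a corner are circumscribed. Then the last black quadrilateral at the corner (the thirteenth quadrilateral) is also circumscribed.
   Context: A quadrilateral is circumscribed if it possesses an inscribed circle (touching its four sides). The configuration: a quadrilateral with sides on lines $\ell_0,\ell_5$ (one pair of opposite sides) and $m_0,m_5$ (the other pair) is cut by lines $\ell_1,\ell_2,\ell_3,\ell_4$, each joining the side on $m_0$ to the side on $m_5$, and lines $m_1,m_2,m_3,m_4$, each joining the side on $\ell_0$ to the side on $\ell_5$; the lines of each family are ordered by index and do not meet lines of the same family inside the quadrilateral. The $25$ small quadrilaterals are those bounded by $\ell_i,\ell_{i+1},m_j,m_{j+1}$, $0\le i,j\le 4$; the black ones are those with $i+j$ even. *)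

theory Defs
  imports "HOL-Analysis.Analysis"
begin

type_synonym point = "real ^ 2"

definition is_line :: "point set \<Rightarrow> bool" where
  "is_line L \<longleftrightarrow> affine L \<and> aff_dim L = 1"

text \<open>
  A quadrilateral is given by its vertices in cyclic order. It is nondegenerate and not
  self-intersecting; convexity is not part of the definition.
\<close>

definition quadrilateral :: "point \<Rightarrow> point \<Rightarrow> point \<Rightarrow> point \<Rightarrow> bool" where
  "quadrilateral A B C D \<longleftrightarrow>
     \<not> collinear {A, B, C} \<and> \<not> collinear {B, C, D} \<and>
     \<not> collinear {C, D, A} \<and> \<not> collinear {D, A, B} \<and>
     closed_segment A B \<inter> closed_segment C D = {} \<and>
     closed_segment B C \<inter> closed_segment D A = {}"

definition quad_boundary :: "point \<Rightarrow> point \<Rightarrow> point \<Rightarrow> point \<Rightarrow> point set" where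
  "quad_boundary A B C D =
     closed_segment A B \<union> closed_segment B C \<union> closed_segment C D \<union> closed_segment D A"

definition quad_region :: "point \<Rightarrow> point \<Rightarrow> point \<Rightarrow> point \<Rightarrow> point set" where
  "quad_region A B C D = quad_boundary A B C D \<union> inside (quad_boundary A B C D)"

text \<open>
  In the plane, a circle of positive radius is tangent to a line iff the two have exactly one
  common point. Touching a side requires moreover that this point lie on the side itself and
  not only on its extension.
\<close>

definition touches_side :: "point \<Rightarrow> real \<Rightarrow> point \<Rightarrow> point \<Rightarrow> bool" where
  "touches_side c r A B \<longleftrightarrow>
     (\<exists>T \<in> closed_segment A B. affine hull {A, B} \<inter> sphere c r = {T})"

definition circumscribed :: "point \<Rightarrow> point \<Rightarrow> point \<Rightarrow> point \<Rightarrow> bool" where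
  "circumscribed A B C D \<longleftrightarrow>
     (\<exists>c r. 0 < r \<and> cball c r \<subseteq> quad_region A B C D \<and>
        touches_side c r A B \<and> touches_side c r B C \<and>
        touches_side c r C D \<and> touches_side c r D A)"

text \<open>
  The points \<open>X 0, \<dots>, X 5\<close> are distinct and occur in this order on a segment from \<open>X 0\<close>
  to \<open>X 5\<close>; in particular \<open>X 1, \<dots>, X 4\<close> lie strictly between \<open>X 0\<close> and \<open>X 5\<close>.
\<close>

definition in_order :: "(nat \<Rightarrow> point) \<Rightarrow> bool" where
  "in_order X \<longleftrightarrow>
     (\<forall>i j k. i < j \<and> j < k \<and> k \<le> 5 \<longrightarrow> X j \<in> open_segment (X i) (X k))"

text \<open>
  \<open>l 0, l 5\<close> and \<open>m 0, m 5\<close> carry the two pairs of opposite sides of the quadrilateral that is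
  cut, and \<open>P i j\<close> is the common point of \<open>l i\<close> and \<open>m j\<close>. The \<open>in_order\<close> conditions say that
  each of \<open>l 1, \<dots>, l 4\<close> joins the side on \<open>m 0\<close> to the side on \<open>m 5\<close>, in the order of
  the indices, and likewise for \<open>m 1, \<dots>, m 4\<close>. Two lines of one family do not meet in the closed
  quadrilateral: if they met on a side, some piece would be a triangle. The lines carrying sides
  belong to the families too, which makes the quadrilateral convex: at a reflex vertex the
  extension of one side would hit the opposite side.
\<close>

definition grid_cut ::
  "(nat \<Rightarrow> point set) \<Rightarrow> (nat \<Rightarrow> point set) \<Rightarrow> (nat \<Rightarrow> nat \<Rightarrow> point) \<Rightarrow> bool" where
  "grid_cut l m P \<longleftrightarrow>
     (\<forall>i\<le>5. is_line (l i) \<and> is_line (m i)) \<and>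
     (\<forall>i\<le>5. \<forall>j\<le>5. l i \<inter> m j = {P i j}) \<and>
     quadrilateral (P 0 0) (P 0 5) (P 5 5) (P 5 0) \<and>
     in_order (\<lambda>i. P i 0) \<and> in_order (\<lambda>i. P i 5) \<and>
     in_order (\<lambda>j. P 0 j) \<and> in_order (\<lambda>j. P 5 j) \<and>
     (\<forall>i k. i < k \<and> k \<le> 5 \<longrightarrow>
        l i \<inter> l k \<inter> quad_region (P 0 0) (P 0 5) (P 5 5) (P 5 0) = {} \<and>
        m i \<inter> m k \<inter> quad_region (P 0 0) (P 0 5) (P 5 5) (P 5 0) = {})"

definition cell_circumscribed :: "(nat \<Rightarrow> nat \<Rightarrow> point) \<Rightarrow> nat \<Rightarrow> nat \<Rightarrow> bool" where
  "cell_circumscribed P i j \<longleftrightarrow>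
     circumscribed (P i j) (P i (Suc j)) (P (Suc i) (Suc j)) (P (Suc i) j)"

end

theory Submission
  imports Defs
begin

text \<open>
  Orient the lines alternately. In Laguerre geometry an oriented line with unit normal \<open>n\<close> and
  offset \<open>h\<close> is the vector \<open>(n, 1, h)\<close> of the projective quadric \<open>\<bar>n\<bar>\<^sup>2 = w\<^sup>2\<close> in the space of
  triples \<open>(n, w, h)\<close>, and an oriented circle is a plane; so a black cell is circumscribed iff the
  points \<open>L i, L (i+1), M j, M (j+1)\<close> are coplanar, that is, iff the chords \<open>A i\<close> through
  \<open>L i, L (i+1)\<close> and \<open>B j\<close> through \<open>M j, M (j+1)\<close> meet.

  The four cells with odd indices yield a pencil of quadrics through \<open>L 1, \<dots>, L 4\<close> and
  \<open>M 1, \<dots>, M 4\<close>, spanned by two products of pairs of planes; take its member \<open>H\<close> through \<open>L 0\<close>.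
  Some combination \<open>G\<close> of \<open>H\<close> and the given quadric contains the line \<open>B 2\<close>. The known incidences
  propagate this successively to \<open>A 2\<close>, \<open>A 0\<close>, \<open>B 0\<close>, \<open>A 4\<close> and \<open>B 4\<close>. As \<open>G\<close> is not zero, the
  line \<open>B 4\<close>, which lies on \<open>G\<close> and meets \<open>A 0\<close> and \<open>A 2\<close>, belongs to the ruling opposite to the
  one of the \<open>A i\<close>, hence meets \<open>A 4\<close>. The argument needs \<open>A 0, A 2, A 4\<close> and \<open>B 0, B 2, B 4\<close> to be
  pairwise skew; if two of them meet, all six pass through the same point.
\<close>

section \<open>The incidence theorem for chords of a quadric\<close>

lemma span_pair_iff: "x \<in> span {u, v} \<longleftrightarrow> (\<exists>a b. x = a *\<^sub>R u + b *\<^sub>R v)"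
  for u v :: "'v::real_vector"
proof
  assume "x \<in> span {u, v}"
  then obtain a b where "x - a *\<^sub>R u - b *\<^sub>R v = 0"
    by (auto simp: span_breakdown_eq)
  then have "x = a *\<^sub>R u + b *\<^sub>R v" by (simp add: algebra_simps)
  then show "\<exists>a b. x = a *\<^sub>R u + b *\<^sub>R v" by blast
next
  assume "\<exists>a b. x = a *\<^sub>R u + b *\<^sub>R v"
  moreover have "u \<in> span {u, v}" "v \<in> span {u, v}" by (auto simp: span_base)
  ultimately show "x \<in> span {u, v}" by (auto simp: span_add span_scale)
qed

text \<open>Two independent vectors of a plane form a basis of it; the last two assumptions express
  independence, and the coefficients come from Cramer's rule.\<close>

lemma span_pair_combination:
  fixes u v :: "'v::real_vector"
  assumes "x \<in> span {u, v}" "y \<in> span {u, v}" "z \<in> span {u, v}"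
    and "y \<noteq> 0" "\<And>t. x \<noteq> t *\<^sub>R y"
  shows "\<exists>s t. z = s *\<^sub>R x + t *\<^sub>R y"
proof -
  obtain a b where x: "x = a *\<^sub>R u + b *\<^sub>R v" using assms(1) span_pair_iff by blast
  obtain c d where y: "y = c *\<^sub>R u + d *\<^sub>R v" using assms(2) span_pair_iff by blast
  obtain e g where z: "z = e *\<^sub>R u + g *\<^sub>R v" using assms(3) span_pair_iff by blast
  have D: "a * d - b * c \<noteq> 0"
  proof
    assume D: "a * d - b * c = 0"
    have "c \<noteq> 0 \<or> d \<noteq> 0" using y \<open>y \<noteq> 0\<close> by auto
    then show False
    proof
      assume "c \<noteq> 0"
      then have "b = (a / c) * d" using D by (simp add: field_simps)
      then have "x = (a / c) *\<^sub>R y" using \<open>c \<noteq> 0\<close> by (simp add: x y scaleR_add_right)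
      then show False using assms(5) by blast
    next
      assume "d \<noteq> 0"
      then have "a = (b / d) * c" using D by (simp add: field_simps)
      then have "x = (b / d) *\<^sub>R y" using \<open>d \<noteq> 0\<close> by (simp add: x y scaleR_add_right)
      then show False using assms(5) by blast
    qed
  qed
  define s where "s = (e * d - g * c) / (a * d - b * c)"
  define t where "t = (a * g - b * e) / (a * d - b * c)"
  have "s * a + t * c = e" "s * b + t * d = g"
    using D unfolding s_def t_def by (simp_all add: divide_simps) (simp_all add: algebra_simps)
  then have "z = s *\<^sub>R x + t *\<^sub>R y"
    unfolding x y z by (metis (no_types, lifting) add.assoc add.left_commute scaleR_add_left scaleR_add_right scaleR_scaleR)
  then show ?thesis by blast
qed

text \<open>Geometrically: the projective line through \<open>u\<close> and \<open>v\<close> lies on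
  the quadric of \<open>G\<close>.\<close>

definition isotropic :: "('v::real_vector \<Rightarrow> 'v \<Rightarrow> real) \<Rightarrow> 'v \<Rightarrow> 'v \<Rightarrow> bool" where
  "isotropic G u v \<longleftrightarrow> G u u = 0 \<and> G u v = 0 \<and> G v v = 0"

locale symmetric_form =
  fixes G :: "'v::real_vector \<Rightarrow> 'v \<Rightarrow> real"
  assumes bilin: "bilinear G" and symm: "G u v = G v u"
begin

lemmas expand = bilinear_ladd[OF bilin] bilinear_radd[OF bilin] bilinear_lmul[OF bilin] bilinear_rmul[OF bilin]

lemma isotropic_span:
  assumes "isotropic G u v" "x \<in> span {u, v}" "y \<in> span {u, v}"
  shows "G x y = 0"
proof -
  have "G v u = 0" using assms(1) symm[of v u] by (simp add: isotropic_def)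
  then show ?thesis
    using assms unfolding span_pair_iff isotropic_def by (auto simp: expand)
qed

lemma square_combination:
  "G (a *\<^sub>R u + b *\<^sub>R v) (a *\<^sub>R u + b *\<^sub>R v) = a\<^sup>2 * G u u + 2 * a * b * G u v + b\<^sup>2 * G v v"
  by (simp add: expand symm[of v u] algebra_simps power2_eq_square)

text \<open>A quadric containing three distinct points of a line contains the line. Here these are
  \<open>w\<close>, \<open>z\<close> and a point that the line shares with another line on the
  quadric; \<open>c\<close> and \<open>d\<close> are nonzero to keep it apart from \<open>w\<close>
  and \<open>z\<close>.\<close>

lemma isotropic_transfer:
  assumes "isotropic G u v" "G w w = 0" "G z z = 0"
    and "a *\<^sub>R u + b *\<^sub>R v = c *\<^sub>R w + d *\<^sub>R z" "c \<noteq> 0" "d \<noteq> 0"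
  shows "isotropic G w z"
proof -
  have "G (c *\<^sub>R w + d *\<^sub>R z) (c *\<^sub>R w + d *\<^sub>R z) = 0"
    unfolding assms(4)[symmetric] square_combination using assms(1) by (simp add: isotropic_def)
  then show ?thesis using assms(2,3,5,6) by (simp add: square_combination isotropic_def)
qed

text \<open>Again three points of a line on a quadric: one of \<open>w\<close>, \<open>z\<close>,
  and the points where the line meets two lines on the quadric. The condition \<open>det\<close>
  keeps these two apart.\<close>

lemma isotropic_from_two_points:
  assumes "isotropic G u v" "isotropic G u' v'" "G w w = 0 \<or> G z z = 0"
    and eq: "a *\<^sub>R u + b *\<^sub>R v = c *\<^sub>R w + d *\<^sub>R z"
            "a' *\<^sub>R u' + b' *\<^sub>R v' = c' *\<^sub>R w + d' *\<^sub>R z"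
    and nz: "c \<noteq> 0" "c' \<noteq> 0" "d \<noteq> 0" "d' \<noteq> 0" and det: "c * d' \<noteq> c' * d"
  shows "isotropic G w z"
proof -
  have "G (c *\<^sub>R w + d *\<^sub>R z) (c *\<^sub>R w + d *\<^sub>R z) = 0"
    unfolding eq(1)[symmetric] square_combination using assms(1) by (simp add: isotropic_def)
  then have 1: "c\<^sup>2 * G w w + 2 * c * d * G w z + d\<^sup>2 * G z z = 0"
    by (simp add: square_combination)
  have "G (c' *\<^sub>R w + d' *\<^sub>R z) (c' *\<^sub>R w + d' *\<^sub>R z) = 0"
    unfolding eq(2)[symmetric] square_combination using assms(2) by (simp add: isotropic_def)
  then have 2: "c'\<^sup>2 * G w w + 2 * c' * d' * G w z + d'\<^sup>2 * G z z = 0"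
    by (simp add: square_combination)
  \<comment> \<open>Eliminate \<open>G z z\<close> from the two equations, which settles the case
    \<open>G w w = 0\<close>; the next identity eliminates \<open>G w w\<close> for the other
    case.\<close>
  have "2 * d * d' * (c * d' - c' * d) * G w z =
      d'\<^sup>2 * (c\<^sup>2 * G w w + 2 * c * d * G w z + d\<^sup>2 * G z z)
      - d\<^sup>2 * (c'\<^sup>2 * G w w + 2 * c' * d' * G w z + d'\<^sup>2 * G z z)
      - (d'\<^sup>2 * c\<^sup>2 - d\<^sup>2 * c'\<^sup>2) * G w w"
    by (simp add: algebra_simps power2_eq_square)
  moreover have "2 * c * c' * (c' * d - c * d') * G w z =
      c'\<^sup>2 * (c\<^sup>2 * G w w + 2 * c * d * G w z + d\<^sup>2 * G z z)
      - c\<^sup>2 * (c'\<^sup>2 * G w w + 2 * c' * d' * G w z + d'\<^sup>2 * G z z)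
      - (c'\<^sup>2 * d\<^sup>2 - c\<^sup>2 * d'\<^sup>2) * G z z"
    by (simp add: algebra_simps power2_eq_square)
  ultimately have "G w z = 0" using 1 2 nz det assms(3) by auto
  then show ?thesis using 1 nz assms(3) by (auto simp: isotropic_def)
qed

end

text \<open>The cell \<open>(4, 4)\<close> is the unknown one; the other corners are reduced to it by reversing
  the numbering.\<close>

definition known_cell :: "nat \<Rightarrow> nat \<Rightarrow> bool" where
  "known_cell i j \<longleftrightarrow> i \<le> 4 \<and> j \<le> 4 \<and> even (i + j) \<and> (i, j) \<noteq> (4, 4)"

text \<open>\<open>q\<close> is the form of the Laguerre quadric, and \<open>f i j\<close> is the
  equation of the plane representing the circle inscribed in cell (i, j). Neighbouring points are
  not \<open>q\<close>-orthogonal, so the chord joining them does not lie on the quadric. The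
  nonzero coefficients in \<open>meet\<close> put the meeting point of two chords away from their
  ends, so that it counts as a third point on each.\<close>

locale checkerboard = q: symmetric_form q
  for q :: "'v::real_vector \<Rightarrow> 'v \<Rightarrow> real" +
  fixes L M :: "nat \<Rightarrow> 'v" and f :: "nat \<Rightarrow> nat \<Rightarrow> 'v \<Rightarrow> real"
  assumes L_null: "i \<le> 5 \<Longrightarrow> q (L i) (L i) = 0"
    and M_null: "i \<le> 5 \<Longrightarrow> q (M i) (M i) = 0"
    and L_adjacent: "i \<le> 4 \<Longrightarrow> q (L i) (L (Suc i)) \<noteq> 0"
    and M_adjacent: "i \<le> 4 \<Longrightarrow> q (M i) (M (Suc i)) \<noteq> 0"
    and f_linear: "known_cell i j \<Longrightarrow> linear (f i j)"
    and f_L: "known_cell i j \<Longrightarrow> f i j (L i) = 0 \<and> f i j (L (Suc i)) = 0"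
    and f_M: "known_cell i j \<Longrightarrow> f i j (M j) = 0 \<and> f i j (M (Suc j)) = 0"
    \<comment> \<open>the parities single out the lines whose orientation rules out tangency to the circle\<close>
    and f_L_away: "known_cell i j \<Longrightarrow> k \<le> 5 \<Longrightarrow>
           Suc i < k \<and> even (i + k) \<or> k < i \<and> odd (i + k) \<Longrightarrow> f i j (L k) \<noteq> 0"
    and f_M_away: "known_cell i j \<Longrightarrow> k \<le> 5 \<Longrightarrow>
           Suc j < k \<and> even (j + k) \<or> k < j \<and> odd (j + k) \<Longrightarrow> f i j (M k) \<noteq> 0"
    and meet: "known_cell i j \<Longrightarrow> \<exists>a b c d. a \<noteq> 0 \<and> b \<noteq> 0 \<and> c \<noteq> 0 \<and> d \<noteq> 0 \<and>
           a *\<^sub>R L i + b *\<^sub>R L (Suc i) = c *\<^sub>R M j + d *\<^sub>R M (Suc j)"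
begin

section \<open>Chords and their meeting points\<close>

definition A :: "nat \<Rightarrow> 'v set" where "A i = span {L i, L (Suc i)}"
definition B :: "nat \<Rightarrow> 'v set" where "B j = span {M j, M (Suc j)}"

lemma A_iff: "x \<in> A i \<longleftrightarrow> (\<exists>a b. x = a *\<^sub>R L i + b *\<^sub>R L (Suc i))"
  by (simp add: A_def span_pair_iff)

lemma B_iff: "x \<in> B i \<longleftrightarrow> (\<exists>a b. x = a *\<^sub>R M i + b *\<^sub>R M (Suc i))"
  by (simp add: B_def span_pair_iff)

text \<open>The axioms are symmetric in the two families, so every result on rows is also one on
  columns.\<close>

lemma swapped: "checkerboard q M L (\<lambda>i j. f j i)"
proof -
  have k: "known_cell j i" if "known_cell i j" for i j
    using that by (auto simp: known_cell_def)
  have m: "\<exists>a b c d. a \<noteq> 0 \<and> b \<noteq> 0 \<and> c \<noteq> 0 \<and> d \<noteq> 0 \<and>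
      a *\<^sub>R M i + b *\<^sub>R M (Suc i) = c *\<^sub>R L j + d *\<^sub>R L (Suc j)" if "known_cell i j" for i j
    using meet[OF k[OF that]] by metis
  show ?thesis
    by (intro checkerboard.intro checkerboard_axioms.intro q.symmetric_form_axioms)
      (rule L_null M_null L_adjacent M_adjacent m
        f_linear[OF k] f_L[OF k] f_M[OF k] f_L_away[OF k] f_M_away[OF k]; assumption)+
qed

lemma f_A: "known_cell i j \<Longrightarrow> x \<in> A i \<Longrightarrow> f i j x = 0"
  using f_L f_linear by (auto simp: A_iff linear_add linear_scale)

lemma f_B: "known_cell i j \<Longrightarrow> x \<in> B j \<Longrightarrow> f i j x = 0"
  using f_M f_linear by (auto simp: B_iff linear_add linear_scale)

text \<open>On \<open>L i\<close>, \<open>L (Suc i)\<close> the Gram matrix of \<open>q\<close> has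
  zero diagonal and nonzero off-diagonal entries, so pairing with either vector isolates the
  coefficient of the other.\<close>

lemma nonzero_combination:
  assumes "i \<le> 4" "a \<noteq> 0 \<or> b \<noteq> 0"
  shows "a *\<^sub>R L i + b *\<^sub>R L (Suc i) \<noteq> 0"
proof
  assume *: "a *\<^sub>R L i + b *\<^sub>R L (Suc i) = 0"
  have "q (L i) (a *\<^sub>R L i + b *\<^sub>R L (Suc i)) = 0" "q (L (Suc i)) (a *\<^sub>R L i + b *\<^sub>R L (Suc i)) = 0"
    by (simp_all add: * bilinear_rzero[OF q.bilin])
  then show False
    using L_null[of i] L_null[of "Suc i"] L_adjacent[of i] q.symm[of "L (Suc i)" "L i"] assms
    by (auto simp: q.expand)
qed

lemma meet_point: "known_cell i j \<Longrightarrow> \<exists>x. x \<noteq> 0 \<and> x \<in> A i \<and> x \<in> B j"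
  by (metis A_iff B_iff known_cell_def meet nonzero_combination)

text \<open>Otherwise the plane \<open>f i j\<close> would contain \<open>A k\<close> as well.\<close>

lemma common_point_in_B:
  assumes ij: "known_cell i j" and kj: "known_cell k j" and "i < k"
    and x: "x \<in> A i" "x \<in> A k"
  shows "x \<in> B j"
proof -
  obtain y where y: "y \<noteq> 0" "y \<in> A k" "y \<in> B j" using meet_point[OF kj] by blast
  \<comment> \<open>Both cells lie in column \<open>j\<close>, so \<open>i\<close> and
    \<open>k\<close> have the same parity, and \<open>f_L_away\<close> applies to
    \<open>L k\<close>.\<close>
  have par: "even (i + k)" "Suc i < k" "k \<le> 5"
    using ij kj \<open>i < k\<close> by (auto simp: known_cell_def) presburger+
  have f: "f i j x = 0" "f i j y = 0" using f_A f_B ij x y by blast+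
  have "\<exists>t. x = t *\<^sub>R y"
  proof (rule ccontr)
    assume "\<nexists>t. x = t *\<^sub>R y"
    then obtain s t where "L k = s *\<^sub>R x + t *\<^sub>R y"
      using span_pair_combination[of x "L k" "L (Suc k)" y "L k"] x y
      by (auto simp: A_def span_base)
    then have "f i j (L k) = 0" using f f_linear[OF ij] by (simp add: linear_add linear_scale)
    then show False using f_L_away[OF ij, of k] par by blast
  qed
  then show ?thesis using y by (auto simp: B_def span_scale)
qed

text \<open>The common point spreads through known cells only: columns 0 and 2 first, from these all
  of rows 0, 2 and 4, and finally column 4 by way of rows 0 and 2.\<close>

lemma two_rows_meet:
  assumes "i < k" "i \<in> {0,2,4}" "k \<in> {0,2,4}" "x \<in> A i" "x \<in> A k"
  shows "x \<in> A 4 \<and> x \<in> B 4"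
proof -
  interpret s: checkerboard q M L "\<lambda>i j. f j i" by (rule swapped)
  have [simp]: "s.A = B" "s.B = A"
    by (simp_all add: fun_eq_iff A_def B_def s.A_def s.B_def)
  have "x \<in> B j" if "j \<in> {0,2}" for j
    using common_point_in_B[of i j k x] assms that by (auto simp: known_cell_def)
  then have "x \<in> A j" if "j \<in> {0,2,4}" for j
    using s.common_point_in_B[of 0 j 2 x] that by (auto simp: known_cell_def)
  then show ?thesis
    using common_point_in_B[of 0 4 2 x] by (auto simp: known_cell_def)
qed

lemma two_columns_meet:
  assumes "j < k" "j \<in> {0,2,4}" "k \<in> {0,2,4}" "x \<in> B j" "x \<in> B k"
  shows "x \<in> A 4 \<and> x \<in> B 4"
proof -
  interpret s: checkerboard q M L "\<lambda>i j. f j i" by (rule swapped)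
  show ?thesis
    using s.two_rows_meet[of j k x] assms by (simp add: A_def B_def s.A_def s.B_def)
qed

lemma isotropic_L:
  assumes "symmetric_form G" "known_cell i j" "isotropic G (M j) (M (Suc j))"
    and "G (L i) (L i) = 0" "G (L (Suc i)) (L (Suc i)) = 0"
  shows "isotropic G (L i) (L (Suc i))"
proof -
  interpret G: symmetric_form G by fact
  show ?thesis
    using meet[OF assms(2)] G.isotropic_transfer[OF assms(3-5)] by metis
qed

text \<open>Propagates to a chord with just one end known to lie on the quadric. The rows
  \<open>i\<close> and \<open>k\<close> supply two further points, and \<open>sep\<close> makes them
  distinct.\<close>

lemma isotropic_M_from_two:
  assumes "symmetric_form G" "known_cell i j" "known_cell k j"
    and "isotropic G (L i) (L (Suc i))" "isotropic G (L k) (L (Suc k))"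
    and "G (M j) (M j) = 0 \<or> G (M (Suc j)) (M (Suc j)) = 0"
    and sep: "\<And>x. x \<in> A i \<Longrightarrow> x \<in> A k \<Longrightarrow> x = 0"
  shows "isotropic G (M j) (M (Suc j))"
proof -
  interpret G: symmetric_form G by fact
  obtain a b c d where 1: "a \<noteq> 0" "b \<noteq> 0" "c \<noteq> 0" "d \<noteq> 0"
      "a *\<^sub>R L i + b *\<^sub>R L (Suc i) = c *\<^sub>R M j + d *\<^sub>R M (Suc j)"
    using meet[OF assms(2)] by blast
  obtain a' b' c' d' where 2: "a' \<noteq> 0" "b' \<noteq> 0" "c' \<noteq> 0" "d' \<noteq> 0"
      "a' *\<^sub>R L k + b' *\<^sub>R L (Suc k) = c' *\<^sub>R M j + d' *\<^sub>R M (Suc j)"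
    using meet[OF assms(3)] by blast
  \<comment> \<open>Otherwise the two meeting points on \<open>B j\<close> would be proportional and
    give a common point of \<open>A i\<close> and \<open>A k\<close>.\<close>
  have "c * d' \<noteq> c' * d"
  proof
    assume "c * d' = c' * d"
    then have "d = (c / c') * d'" using 2 by (simp add: field_simps)
    then have "c *\<^sub>R M j + d *\<^sub>R M (Suc j) = (c / c') *\<^sub>R (c' *\<^sub>R M j + d' *\<^sub>R M (Suc j))"
      using 2 by (simp add: scaleR_add_right)
    also have "\<dots> = (c / c') *\<^sub>R (a' *\<^sub>R L k + b' *\<^sub>R L (Suc k))" by (simp add: 2)
    also have "\<dots> \<in> A k" by (auto simp: A_iff scaleR_add_right)
    finally have "a *\<^sub>R L i + b *\<^sub>R L (Suc i) = 0"
      using sep[of "a *\<^sub>R L i + b *\<^sub>R L (Suc i)"] 1(5) A_iff by metis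
    then show False using nonzero_combination[of i a b] 1 assms(2) by (simp add: known_cell_def)
  qed
  then show ?thesis
    using G.isotropic_from_two_points[OF assms(4,5,6) 1(5) 2(5) 1(3) 2(3) 1(4) 2(4)] by blast
qed

text \<open>The case of skew chords. Once all six even chords lie on the quadric of
  \<open>G\<close>, coordinates with respect to four meeting points show that \<open>A 4\<close> and
  \<open>B 4\<close> belong to opposite rulings.\<close>

lemma corner_meets_separated:
  assumes sepA: "\<And>i k x. i < k \<Longrightarrow> i \<in> {0,2,4} \<Longrightarrow> k \<in> {0,2,4} \<Longrightarrow> x \<in> A i \<Longrightarrow> x \<in> A k \<Longrightarrow> x = 0"
    and sepB: "\<And>j k x. j < k \<Longrightarrow> j \<in> {0,2,4} \<Longrightarrow> k \<in> {0,2,4} \<Longrightarrow> x \<in> B j \<Longrightarrow> x \<in> B k \<Longrightarrow> x = 0"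
  shows "\<exists>x. x \<noteq> 0 \<and> x \<in> A 4 \<and> x \<in> B 4"
proof -
  interpret s: checkerboard q M L "\<lambda>i j. f j i" by (rule swapped)
  have AB [simp]: "s.A = B" "s.B = A"
    by (simp_all add: fun_eq_iff A_def B_def s.A_def s.B_def)
  have K: "known_cell i j" if "i \<le> 4" "j \<le> 4" "even i \<longleftrightarrow> even j" "i < 4 \<or> j < 4" for i j
    using that by (auto simp: known_cell_def)
  have sub: "L i \<in> A i" "L (Suc i) \<in> A i" "M i \<in> B i" "M (Suc i) \<in> B i" for i
    by (simp_all add: A_def B_def span_base)
  have mem: "L 1 \<in> A 1" "L 2 \<in> A 1" "L 3 \<in> A 3" "L 4 \<in> A 3"
            "M 1 \<in> B 1" "M 2 \<in> B 1" "M 3 \<in> B 3" "M 4 \<in> B 3"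
    using sub[of 1] sub[of 3] by (simp_all add: eval_nat_numeral)
  define f11 f13 f31 f33 where "f11 = f 1 1" and "f13 = f 1 3" and "f31 = f 3 1" and "f33 = f 3 3"
  have lin: "linear (f11)" "linear (f33)" "linear (f13)" "linear (f31)"
    unfolding f11_def f33_def f13_def f31_def by (rule f_linear[OF K]; simp)+
  have z11: "f11 (L 1) = 0" "f11 (L 2) = 0" "f11 (M 1) = 0" "f11 (M 2) = 0"
    and z33: "f33 (L 3) = 0" "f33 (L 4) = 0" "f33 (M 3) = 0" "f33 (M 4) = 0"
    and z13: "f13 (L 1) = 0" "f13 (L 2) = 0" "f13 (M 3) = 0" "f13 (M 4) = 0"
    and z31: "f31 (L 3) = 0" "f31 (L 4) = 0" "f31 (M 1) = 0" "f31 (M 2) = 0"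
    unfolding f11_def f33_def f13_def f31_def by (rule f_A[OF K] f_B[OF K]; (simp; fail | rule mem))+
  \<comment> \<open>These four values will show that a member of the pencil that is degenerate
    enough has \<open>\<alpha> = \<beta> = 0\<close>.\<close>
  have n: "f11 (M 3) \<noteq> 0" "f33 (L 2) \<noteq> 0" "f13 (M 2) \<noteq> 0" "f31 (L 2) \<noteq> 0"
    unfolding f11_def f33_def f13_def f31_def by (rule f_M_away f_L_away; simp add: K)+

  \<comment> \<open>Passing through \<open>L 0\<close> is one linear condition on the two
    coefficients, so it has a nontrivial solution.\<close>
  obtain \<alpha> \<beta> where ab: "\<alpha> \<noteq> 0 \<or> \<beta> \<noteq> 0"
      "\<alpha> * (f11 (L 0) * f33 (L 0)) + \<beta> * (f13 (L 0) * f31 (L 0)) = 0"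
  proof (cases "f13 (L 0) * f31 (L 0) = 0")
    case True
    then show thesis using that[of 0 1] by simp
  next
    case False
    then show thesis
      using that[of "f13 (L 0) * f31 (L 0)" "- (f11 (L 0) * f33 (L 0))"] by simp
  qed
  \<comment> \<open>both products vanish on the lines \<open>A 1, A 3, B 1, B 3\<close>\<close>
  define H where "H u v = \<alpha> * (f11 u * f33 v + f11 v * f33 u)
      + \<beta> * (f13 u * f31 v + f13 v * f31 u)" for u v
  \<comment> \<open>Chosen so that \<open>G (M 2) (M 3) = 0\<close>. Subtracting a multiple of
    \<open>q\<close> keeps the values at all \<open>L i\<close> and \<open>M i\<close>, which are
    null vectors of \<open>q\<close>.\<close>
  define \<rho> where "\<rho> = H (M 2) (M 3) / q (M 2) (M 3)"
  define G where "G u v = H u v - \<rho> * q u v" for u v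
  have G: "symmetric_form G"
  proof
    show "G u v = G v u" for u v
      unfolding G_def H_def using q.symm[of u v] by (simp add: algebra_simps)
    have "G u (x + y) = G u x + G u y" "G u (c *\<^sub>R x) = c *\<^sub>R G u x"
         "G (x + y) u = G x u + G y u" "G (c *\<^sub>R x) u = c *\<^sub>R G x u" for u x y c
      unfolding G_def H_def
      by (simp_all add: linear_add[OF lin(1)] linear_add[OF lin(2)] linear_add[OF lin(3)] linear_add[OF lin(4)]
         linear_scale[OF lin(1)] linear_scale[OF lin(2)] linear_scale[OF lin(3)] linear_scale[OF lin(4)]
         q.expand algebra_simps)
    then show "bilinear G" by (auto simp: bilinear_def linear_iff)
  qed
  then interpret G: symmetric_form G .

  \<comment> \<open>\<open>L 5\<close>, \<open>M 0\<close> and \<open>M 5\<close> are still missing;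
    they join the quadric only with the lines \<open>A 4\<close>, \<open>B 0\<close> and
    \<open>B 4\<close>.\<close>
  have GL: "G (L i) (L i) = 0" if "i \<in> {0,1,2,3,4}" for i
    using that ab L_null[of i] unfolding G_def H_def
    by (elim insertE) (auto simp: z11 z13 z31 z33 algebra_simps simp del: One_nat_def)
  have GM: "G (M i) (M i) = 0" if "i \<in> {1,2,3,4}" for i
    using that M_null[of i] unfolding G_def H_def
    by (elim insertE) (auto simp: z11 z13 z31 z33 algebra_simps simp del: One_nat_def)
  have B2: "isotropic G (M 2) (M (Suc 2))"
    using GM M_adjacent[of 2] by (simp add: isotropic_def G_def \<rho>_def)
  have A2: "isotropic G (L 2) (L (Suc 2))"
    using isotropic_L[OF G K B2, of 2] GL by simp
  have A0: "isotropic G (L 0) (L (Suc 0))"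
    using isotropic_L[OF G K B2, of 0] GL by simp
  \<comment> \<open>From here on one end of each chord is known to lie on \<open>G\<close>, so two
    meeting points are required.\<close>
  have B0: "isotropic G (M 0) (M (Suc 0))"
    using isotropic_M_from_two[OF G K K A0 A2] GM[of 1] sepA[of 0 2] by simp
  have A4: "isotropic G (L 4) (L (Suc 4))"
    using s.isotropic_M_from_two[OF G _ _ B0 B2, of 4] GL[of 4] sepB[of 0 2]
    by (simp add: known_cell_def)
  have B4: "isotropic G (M 4) (M (Suc 4))"
    using isotropic_M_from_two[OF G K K A0 A2, of 4] GM[of 4] sepA[of 0 2] by simp

  have "\<forall>i j. \<exists>x. known_cell i j \<longrightarrow> x \<noteq> 0 \<and> x \<in> A i \<and> x \<in> B j"
    using meet_point by blast
  then obtain X where X: "\<And>i j. known_cell i j \<Longrightarrow> X i j \<noteq> 0 \<and> X i j \<in> A i \<and> X i j \<in> B j"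
    by metis
  \<comment> \<open>Two meeting points on the same chord are independent because the crossing chords
    are skew; they therefore serve as a basis of it.\<close>
  have comb_A: "\<exists>s t. z = s *\<^sub>R X i j + t *\<^sub>R X i k"
    if "z \<in> A i" "known_cell i j" "known_cell i k" "j < k" "j \<in> {0,2,4}" "k \<in> {0,2,4}" for z i j k
  proof (rule span_pair_combination[of _ "L i" "L (Suc i)"])
    show "X i j \<noteq> t *\<^sub>R X i k" for t
      using X that sepB[of j k "X i j"] by (metis B_def span_scale)
  qed (use X that in \<open>auto simp: A_def\<close>)
  have comb_B: "\<exists>s t. z = s *\<^sub>R X j i + t *\<^sub>R X k i"
    if "z \<in> B i" "known_cell j i" "known_cell k i" "j < k" "j \<in> {0,2,4}" "k \<in> {0,2,4}" for z i j k
  proof (rule span_pair_combination[of _ "M i" "M (Suc i)"])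
    show "X j i \<noteq> t *\<^sub>R X k i" for t
      using X that sepA[of j k "X j i"] by (metis A_def span_scale)
  qed (use X that in \<open>auto simp: B_def\<close>)
  have k: "known_cell i j" if "i \<in> {0,2,4}" "j \<in> {0,2}" for i j
    using that by (auto simp: known_cell_def)
  have k': "known_cell j i" if "i \<in> {0,2,4}" "j \<in> {0,2}" for i j
    using that by (auto simp: known_cell_def)
  obtain s t where X40: "X 4 0 = s *\<^sub>R X 0 0 + t *\<^sub>R X 2 0"
    using comb_B[of "X 4 0" 0 0 2] X[OF k, of 4 0] k by auto
  obtain s' t' where X42: "X 4 2 = s' *\<^sub>R X 0 2 + t' *\<^sub>R X 2 2"
    using comb_B[of "X 4 2" 2 0 2] X[OF k, of 4 2] k by auto
  obtain u v where X04: "X 0 4 = u *\<^sub>R X 0 0 + v *\<^sub>R X 0 2"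
    using comb_A[of "X 0 4" 0 0 2] X[OF k', of 4 0] k by auto
  obtain u' v' where X24: "X 2 4 = u' *\<^sub>R X 2 0 + v' *\<^sub>R X 2 2"
    using comb_A[of "X 2 4" 2 0 2] X[OF k', of 4 2] k by auto
  have A_scale: "c *\<^sub>R x \<in> A i" if "x \<in> A i" for c x i using that by (simp add: A_def span_scale)
  have B_scale: "c *\<^sub>R x \<in> B i" if "x \<in> B i" for c x i using that by (simp add: B_def span_scale)
  \<comment> \<open>A vanishing coefficient would put a meeting point on two skew chords. The three
    facts are used to show that the final witness is nonzero.\<close>
  have "s' \<noteq> 0"
  proof
    assume "s' = 0"
    then have "X 4 2 \<in> A 2" using X42 X[OF k, of 2 2] by (simp add: A_scale)
    then show False using sepA[of 2 4 "X 4 2"] X[OF k, of 4 2] by auto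
  qed
  have "u' \<noteq> 0"
  proof
    assume "u' = 0"
    then have "X 2 4 \<in> B 2" using X24 X[OF k, of 2 2] by (simp add: B_scale)
    then show False using sepB[of 2 4 "X 2 4"] X[OF k', of 4 2] by auto
  qed
  have "u \<noteq> 0"
  proof
    assume "u = 0"
    then have "X 0 4 \<in> B 2" using X04 X[OF k, of 0 2] by (simp add: B_scale)
    then show False using sepB[of 2 4 "X 0 4"] X[OF k', of 4 0] by auto
  qed
  have GA: "G x y = 0" if "x \<in> A i" "y \<in> A i" "i \<in> {0,2,4}" for x y i
    using that G.isotropic_span A0 A2 A4 unfolding A_def by auto
  have GB: "G x y = 0" if "x \<in> B i" "y \<in> B i" "i \<in> {0,2,4}" for x y i
    using that G.isotropic_span B0 B2 B4 unfolding B_def by auto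
  note XX = X[OF k, of 0 0] X[OF k, of 0 2] X[OF k, of 2 0] X[OF k, of 2 2]
    X[OF k, of 4 0] X[OF k, of 4 2] X[OF k', of 4 0] X[OF k', of 4 2]
  \<comment> \<open>Adjacent vertices of the skew quadrilateral \<open>X 0 0\<close>,
    \<open>X 0 2\<close>, \<open>X 2 2\<close>, \<open>X 2 0\<close> share a line on
    \<open>G\<close>, so only the two diagonal products can differ from zero.\<close>
  define \<kappa> where "\<kappa> = G (X 0 0) (X 2 2)"
  define \<kappa>' where "\<kappa>' = G (X 2 0) (X 0 2)"
  have G0: "G (X 0 0) (X 0 0) = 0" "G (X 0 0) (X 0 2) = 0" "G (X 0 2) (X 0 2) = 0"
    "G (X 2 0) (X 2 0) = 0" "G (X 2 0) (X 2 2) = 0" "G (X 2 2) (X 2 2) = 0"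
    using GA[of _ 0] GA[of _ 2] XX by auto
  have G1: "G (X 0 0) (X 2 0) = 0" "G (X 0 2) (X 2 2) = 0"
    using GB[of _ 0] GB[of _ 2] XX by auto
  have "G (X 4 0) (X 4 2) = 0" using GA[of _ 4] XX by auto
  then have eq1: "s * t' * \<kappa> + t * s' * \<kappa>' = 0"
    unfolding X40 X42 by (simp add: G.expand G0 G1 \<kappa>_def \<kappa>'_def algebra_simps)
  have "G (X 0 4) (X 2 4) = 0" using GB[of _ 4] XX by auto
  then have eq2: "u * v' * \<kappa> + v * u' * \<kappa>' = 0"
    unfolding X04 X24
    by (simp add: G.expand G0 G1 \<kappa>_def \<kappa>'_def G.symm[of "X 0 2" "X 2 0"] algebra_simps)

  \<comment> \<open>If both were zero, \<open>G\<close> would vanish on the span of the four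
    vertices, which contains \<open>L 1\<close>, \<open>L 2\<close>, \<open>M 2\<close> and
    \<open>M 3\<close>. The pair \<open>L 1\<close>, \<open>L 2\<close> then forces
    \<open>\<rho> = 0\<close>, and pairing \<open>L 2\<close> with \<open>M 2\<close> and
    \<open>M 3\<close> forces \<open>\<beta> = 0\<close> and \<open>\<alpha> = 0\<close>.\<close>
  have "\<kappa> \<noteq> 0 \<or> \<kappa>' \<noteq> 0"
  proof (rule ccontr)
    assume "\<not> ?thesis"
    then have "\<kappa> = 0" "\<kappa>' = 0" by auto
    then have G2: "G (X 0 0) (X 2 2) = 0" "G (X 2 0) (X 0 2) = 0" "G (X 0 2) (X 2 0) = 0"
      using G.symm[of "X 2 0" "X 0 2"] by (simp_all add: \<kappa>_def \<kappa>'_def)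
    have "L 1 \<in> A 0" "L 2 \<in> A 2" "M 2 \<in> B 2" "M 3 \<in> B 2"
      using sub[of 0] sub[of 2] by (simp_all add: eval_nat_numeral)
    then obtain a b c d e g h i where *: "L 1 = a *\<^sub>R X 0 0 + b *\<^sub>R X 0 2"
        "L 2 = c *\<^sub>R X 2 0 + d *\<^sub>R X 2 2" "M 2 = e *\<^sub>R X 0 2 + g *\<^sub>R X 2 2"
        "M 3 = h *\<^sub>R X 0 2 + i *\<^sub>R X 2 2"
      using comb_A[of "L 1" 0 0 2] comb_A[of "L 2" 2 0 2] comb_B[of "M 2" 2 0 2]
        comb_B[of "M 3" 2 0 2] k by auto
    have "G (L 1) (L 2) = 0" "G (M 2) (L 2) = 0" "G (M 3) (L 2) = 0"
      unfolding * by (simp_all add: G.expand G0 G1 G2 G.symm[of "X 2 2" "X 2 0"])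
    moreover have "H (L 1) (L 2) = 0" by (simp add: H_def z11 z13 del: One_nat_def)
    moreover have "q (L 1) (L 2) \<noteq> 0" using L_adjacent[of 1] by (simp add: eval_nat_numeral)
    ultimately have "H (M 2) (L 2) = 0" "H (M 3) (L 2) = 0" by (auto simp: G_def)
    then show False using ab(1) n by (auto simp: H_def z11 z13 z31 z33)
  qed
  then have det: "s * t' * v * u' = t * s' * u * v'"
  proof
    assume "\<kappa> \<noteq> 0"
    have "(s * t' * v * u' - t * s' * u * v') * \<kappa> = v * u' * (s * t' * \<kappa> + t * s' * \<kappa>')
        - t * s' * (u * v' * \<kappa> + v * u' * \<kappa>')" by (simp add: algebra_simps)
    then show ?thesis using eq1 eq2 \<open>\<kappa> \<noteq> 0\<close> by simp
  next
    assume "\<kappa>' \<noteq> 0"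
    have "(t * s' * u * v' - s * t' * v * u') * \<kappa>' = u * v' * (s * t' * \<kappa> + t * s' * \<kappa>')
        - s * t' * (u * v' * \<kappa> + v * u' * \<kappa>')" by (simp add: algebra_simps)
    then show ?thesis using eq1 eq2 \<open>\<kappa>' \<noteq> 0\<close> by simp
  qed
  \<comment> \<open>The coefficients make the components along \<open>X 0 0\<close>,
    \<open>X 0 2\<close> and \<open>X 2 0\<close> agree in the two expressions for \<open>x\<close>;
    those along \<open>X 2 2\<close> agree by \<open>det\<close>.\<close>
  define x where "x = (u * s' * u') *\<^sub>R X 4 0 + (s * v * u') *\<^sub>R X 4 2"
  have x': "x = (s * s' * u') *\<^sub>R X 0 4 + (t * u * s') *\<^sub>R X 2 4"
    unfolding x_def X40 X42 X04 X24 using det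
    by (simp add: scaleR_add_right algebra_simps)
  have "x \<in> A 4" unfolding x_def using XX by (auto simp: A_def intro!: span_add span_scale)
  moreover have "x \<in> B 4" unfolding x' using XX by (auto simp: B_def intro!: span_add span_scale)
  moreover have "x \<noteq> 0"
  proof
    assume "x = 0"
    then have "(u * s' * u') *\<^sub>R X 4 0 = (- (s * v * u')) *\<^sub>R X 4 2"
      unfolding x_def by (simp add: eq_neg_iff_add_eq_0)
    moreover have "X 4 0 \<in> B 0" "X 4 2 \<in> B 2" using XX by auto
    ultimately have "(u * s' * u') *\<^sub>R X 4 0 \<in> B 0" "(u * s' * u') *\<^sub>R X 4 0 \<in> B 2"
      using B_scale by metis+
    then show False
      using sepB[of 0 2 "(u * s' * u') *\<^sub>R X 4 0"] XX \<open>u \<noteq> 0\<close> \<open>s' \<noteq> 0\<close> \<open>u' \<noteq> 0\<close> by auto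
  qed
  ultimately show ?thesis by blast
qed

lemma corner_meets: "\<exists>x. x \<noteq> 0 \<and> x \<in> A 4 \<and> x \<in> B 4"
proof (cases "\<exists>i k x. i < k \<and> i \<in> {0,2,4} \<and> k \<in> {0,2,4} \<and> x \<noteq> 0 \<and> (x \<in> A i \<and> x \<in> A k \<or> x \<in> B i \<and> x \<in> B k)")
  case True
  then show ?thesis using two_rows_meet two_columns_meet by metis
next
  case False
  show ?thesis by (rule corner_meets_separated) (use False in blast)+
qed

end

section \<open>Oriented lines and circles\<close>

lemma inner_real2: "u \<bullet> v = u $ 1 * v $ 1 + u $ 2 * v $ 2" for u v :: "real^2"
  by (simp add: inner_vec_def sum_2)

definition cross2 :: "real^2 \<Rightarrow> real^2 \<Rightarrow> real" where
  "cross2 u v = u $ 1 * v $ 2 - u $ 2 * v $ 1"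

lemma cross2_parallel:
  assumes "u \<noteq> 0" "cross2 u v = 0"
  shows "\<exists>t. v = t *\<^sub>R u"
proof -
  \<comment> \<open>Expansion of \<open>v\<close> along \<open>u\<close> and its perpendicular; the
    perpendicular component is \<open>cross2 u v\<close>.\<close>
  have "(u \<bullet> u) *\<^sub>R v = (u \<bullet> v) *\<^sub>R u"
    using assms(2) by (simp add: vec_eq_iff forall_2 inner_real2 cross2_def) algebra
  then have "v = ((u \<bullet> v) / (u \<bullet> u)) *\<^sub>R u"
    using assms(1) by (metis (no_types, lifting) divide_inverse_commute inner_eq_zero_iff
        scaleR_left_commute scaleR_scaleR vector_fraction_eq_iff)
  then show ?thesis by blast
qed

lemma orthogonal_parallel:
  fixes n u v :: "real^2"
  assumes "n \<noteq> 0" "u \<noteq> 0" "n \<bullet> u = 0" "n \<bullet> v = 0"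
  shows "\<exists>t. v = t *\<^sub>R u"
proof (rule cross2_parallel[OF assms(2)])
  have "n $ 1 * cross2 u v = 0" "n $ 2 * cross2 u v = 0"
    using assms(3,4) unfolding inner_real2 cross2_def by algebra+
  then show "cross2 u v = 0" using assms(1) by (auto simp: vec_eq_iff forall_2)
qed

text \<open>Twice the signed area of the triangle, equally the 3 by 3 determinant of the rows (u,
  1), (v, 1), (w, 1).\<close>

definition tri :: "real^2 \<Rightarrow> real^2 \<Rightarrow> real^2 \<Rightarrow> real" where
  "tri u v w = cross2 (v - u) (w - u)"

lemma unit_inner: "norm u = 1 \<Longrightarrow> u \<bullet> u = 1" for u :: "'a::real_inner"
  by (simp add: norm_eq_1)

text \<open>A line meets the unit circle in at most two points.\<close>

lemma tri_unit_nonzero: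
  assumes "norm u = 1" "norm v = 1" "norm w = 1" "u \<noteq> v" "v \<noteq> w" "u \<noteq> w"
  shows "tri u v w \<noteq> 0"
proof
  assume "tri u v w = 0"
  then obtain t where t: "w - u = t *\<^sub>R (v - u)"
    using cross2_parallel[of "v - u" "w - u"] assms by (auto simp: tri_def)
  define a where "a = v - u"
  have v: "v = u + a" and w: "w = u + t *\<^sub>R a" using t by (auto simp: a_def algebra_simps)
  have 1: "2 * (u \<bullet> a) + a \<bullet> a = 0"
    using unit_inner[OF assms(1)] unit_inner[OF assms(2)] unfolding v
    by (simp add: inner_add_left inner_add_right inner_commute)
  have "2 * t * (u \<bullet> a) + t * t * (a \<bullet> a) = 0"
    using unit_inner[OF assms(1)] unit_inner[OF assms(3)] unfolding w
    by (simp add: inner_add_left inner_add_right inner_commute)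
  moreover have "t * (t - 1) * (a \<bullet> a) = (2 * t * (u \<bullet> a) + t * t * (a \<bullet> a)) - t * (2 * (u \<bullet> a) + a \<bullet> a)"
    by (simp add: algebra_simps)
  ultimately have "t * (t - 1) * (a \<bullet> a) = 0" using 1 by simp
  then show False using assms v w by auto
qed

type_synonym cycle_space = "(real^2) \<times> real \<times> real"

definition lift :: "real^2 \<Rightarrow> real \<Rightarrow> cycle_space" where "lift n h = (n, 1, h)"

text \<open>Since each offset is the same affine function of its normal, a relation between the
  lifts is just an affine relation between four points of the plane. Its coefficients are signed
  areas, nonzero because no three points of a circle are collinear.\<close>

lemma lift_meet:
  assumes "norm u1 = 1" "norm u2 = 1" "norm u3 = 1" "norm u4 = 1"
    and "u1 \<noteq> u2" "u1 \<noteq> u3" "u1 \<noteq> u4" "u2 \<noteq> u3" "u2 \<noteq> u4" "u3 \<noteq> u4"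
    and "u1 \<bullet> p - s = h1" "u2 \<bullet> p - s = h2" "u3 \<bullet> p - s = h3" "u4 \<bullet> p - s = h4"
  shows "\<exists>a b c d. a \<noteq> 0 \<and> b \<noteq> 0 \<and> c \<noteq> 0 \<and> d \<noteq> 0 \<and>
    a *\<^sub>R lift u1 h1 + b *\<^sub>R lift u2 h2 = c *\<^sub>R lift u3 h3 + d *\<^sub>R lift u4 h4"
proof (intro exI conjI)
  show "tri u2 u3 u4 *\<^sub>R lift u1 h1 + (- tri u1 u3 u4) *\<^sub>R lift u2 h2 =
      (- tri u1 u2 u4) *\<^sub>R lift u3 h3 + tri u1 u2 u3 *\<^sub>R lift u4 h4"
    unfolding assms(11-14)[symmetric]
    by (simp add: lift_def tri_def cross2_def inner_real2 vec_eq_iff forall_2 algebra_simps)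
qed (use tri_unit_nonzero assms in auto)

text \<open>Three distinct unit normals already determine the oriented circle, and the relation
  carries tangency over to the fourth line once \<open>d\<close> is nonzero. If \<open>d\<close>
  were zero, the affine independence of \<open>u1\<close>, \<open>u2\<close>, \<open>u3\<close>
  would give \<open>a = b = 0\<close>. The sign of \<open>s\<close> stays open.\<close>

lemma meet_imp_circle:
  assumes "norm u1 = 1" "norm u2 = 1" "norm u3 = 1" "u1 \<noteq> u2" "u1 \<noteq> u3" "u2 \<noteq> u3"
    and eq: "a *\<^sub>R lift u1 h1 + b *\<^sub>R lift u2 h2 = c *\<^sub>R lift u3 h3 + d *\<^sub>R lift u4 h4"
    and nz: "a *\<^sub>R lift u1 h1 + b *\<^sub>R lift u2 h2 \<noteq> 0"
  shows "\<exists>p s. u1 \<bullet> p - s = h1 \<and> u2 \<bullet> p - s = h2 \<and> u3 \<bullet> p - s = h3 \<and> u4 \<bullet> p - s = h4"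
proof -
  define D where "D = tri u1 u2 u3"
  have D: "D \<noteq> 0" using tri_unit_nonzero assms by (simp add: D_def)
  \<comment> \<open>Cramer's rule for the system stating that
    \<open>(u2 - u1) \<bullet> p = h2 - h1\<close> and
    \<open>(u3 - u1) \<bullet> p = h3 - h1\<close>.\<close>
  define p :: "real^2" where
    "p = vector [((h2 - h1) * (u3$2 - u1$2) - (h3 - h1) * (u2$2 - u1$2)) / D,
                 ((u2$1 - u1$1) * (h3 - h1) - (u3$1 - u1$1) * (h2 - h1)) / D]"
  have p: "p $ 1 * D = (h2 - h1) * (u3$2 - u1$2) - (h3 - h1) * (u2$2 - u1$2)"
          "p $ 2 * D = (u2$1 - u1$1) * (h3 - h1) - (u3$1 - u1$1) * (h2 - h1)"
    using D by (simp_all add: p_def)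
  have "D * ((u2 - u1) \<bullet> p - (h2 - h1)) = 0" "D * ((u3 - u1) \<bullet> p - (h3 - h1)) = 0"
    using p unfolding inner_real2 D_def tri_def cross2_def vector_minus_component by algebra+
  then have p2: "(u2 - u1) \<bullet> p = h2 - h1" "(u3 - u1) \<bullet> p = h3 - h1" using D by auto
  define s where "s = u1 \<bullet> p - h1"
  have e: "u1 \<bullet> p - s = h1" "u2 \<bullet> p - s = h2" "u3 \<bullet> p - s = h3"
    using p2 by (auto simp: s_def inner_diff_left)
  have E: "a *\<^sub>R u1 + b *\<^sub>R u2 = c *\<^sub>R u3 + d *\<^sub>R u4" "a + b = c + d"
      "a * h1 + b * h2 = c * h3 + d * h4"
    using eq by (simp_all add: lift_def)
  have "d \<noteq> 0"
  proof
    assume "d = 0"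
    then have E': "a * u1$1 + b * u2$1 = c * u3$1" "a * u1$2 + b * u2$2 = c * u3$2" "a + b = c"
      using E by (auto simp: vec_eq_iff forall_2)
    have "a * D = 0" "b * D = 0"
      using E' unfolding D_def tri_def cross2_def vector_minus_component by algebra+
    then show False using D nz by simp
  qed
  have "(a *\<^sub>R u1 + b *\<^sub>R u2) \<bullet> p - (a + b) * s = a * h1 + b * h2"
    using e(1,2) by (simp add: inner_add_left algebra_simps flip: e(1,2))
  moreover have "(c *\<^sub>R u3 + d *\<^sub>R u4) \<bullet> p - (c + d) * s = c * h3 + d * (u4 \<bullet> p - s)"
    by (simp add: inner_add_left algebra_simps flip: e(3))
  ultimately have "d * (u4 \<bullet> p - s) = d * h4" unfolding E by simp
  then show ?thesis using e \<open>d \<noteq> 0\<close> by auto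
qed

text \<open>Lines are numbered up to 5, so reversal is \<open>5 - k\<close>; the matching reversal
  of cells, which are numbered up to 4, is \<open>4 - i\<close>.\<close>

definition corner_flip :: "nat \<Rightarrow> nat \<Rightarrow> nat" where
  "corner_flip a k = (if a = 4 then k else 5 - k)"

text \<open>Multiply the normal of line k by (-1)^k. As i + j is even, the signed distances from the
  centre of a black cell (i, j) to its four sides all become \<open>(-1) ^ i * r i j\<close>, so the
  incircle is a single oriented circle touching four oriented lines.\<close>

lemma corner_circle:
  fixes n n' :: "nat \<Rightarrow> real^2" and h h' :: "nat \<Rightarrow> real"
    and c :: "nat \<Rightarrow> nat \<Rightarrow> real^2" and r :: "nat \<Rightarrow> nat \<Rightarrow> real"
  assumes unit: "\<And>i. i \<le> 5 \<Longrightarrow> norm (n i) = 1" "\<And>i. i \<le> 5 \<Longrightarrow> norm (n' i) = 1"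
    and adj: "\<And>i. i \<le> 4 \<Longrightarrow> n i \<noteq> - n (Suc i)" "\<And>i. i \<le> 4 \<Longrightarrow> n' i \<noteq> - n' (Suc i)"
    and trans: "\<And>i j. i \<le> 5 \<Longrightarrow> j \<le> 5 \<Longrightarrow> n i \<noteq> n' j" "\<And>i j. i \<le> 5 \<Longrightarrow> j \<le> 5 \<Longrightarrow> n i \<noteq> - n' j"
    and a: "a \<in> {0,4}" and b: "b \<in> {0,4}"
    and r: "\<And>i j. black i j \<Longrightarrow> r i j > 0"
    and tang: "\<And>i j. black i j \<Longrightarrow> n i \<bullet> c i j - h i = r i j"
      "\<And>i j. black i j \<Longrightarrow> n (Suc i) \<bullet> c i j - h (Suc i) = - r i j"
      "\<And>i j. black i j \<Longrightarrow> n' j \<bullet> c i j - h' j = r i j"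
      "\<And>i j. black i j \<Longrightarrow> n' (Suc j) \<bullet> c i j - h' (Suc j) = - r i j"
    and away: "\<And>i j k. black i j \<Longrightarrow> k < i \<Longrightarrow> n k \<bullet> c i j - h k > 0"
      "\<And>i j k. black i j \<Longrightarrow> Suc i < k \<Longrightarrow> k \<le> 5 \<Longrightarrow> n k \<bullet> c i j - h k < 0"
      "\<And>i j k. black i j \<Longrightarrow> k < j \<Longrightarrow> n' k \<bullet> c i j - h' k > 0"
      "\<And>i j k. black i j \<Longrightarrow> Suc j < k \<Longrightarrow> k \<le> 5 \<Longrightarrow> n' k \<bullet> c i j - h' k < 0"
    and black: "\<And>i j. black i j \<longleftrightarrow> i \<le> 4 \<and> j \<le> 4 \<and> even (i + j) \<and> (i, j) \<noteq> (a, b)"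
  shows "\<exists>p s. n a \<bullet> p - h a = s \<and> n (Suc a) \<bullet> p - h (Suc a) = - s \<and>
               n' b \<bullet> p - h' b = s \<and> n' (Suc b) \<bullet> p - h' (Suc b) = - s"
proof -
  define u where "u k = (-1) ^ k *\<^sub>R n k" for k
  define u' where "u' k = (-1) ^ k *\<^sub>R n' k" for k
  define g where "g k = (-1) ^ k * h k" for k
  define g' where "g' k = (-1) ^ k * h' k" for k
  \<comment> \<open>neighbouring black cells lie on different sides of their common lines, so the orientation
    of the circle alternates with \<open>i\<close>\<close>
  define F :: "nat \<Rightarrow> nat \<Rightarrow> cycle_space \<Rightarrow> real" where
    "F i j = (\<lambda>(v, w, t). v \<bullet> c i j - (-1) ^ i * r i j * w - t)" for i j
  define q :: "cycle_space \<Rightarrow> cycle_space \<Rightarrow> real" where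
    "q x y = fst x \<bullet> fst y - fst (snd x) * fst (snd y)" for x y
  define L where "L k = lift (u k) (g k)" for k
  define M where "M k = lift (u' k) (g' k)" for k
  have nu: "norm (u k) = 1" "norm (u' k) = 1" if "k \<le> 5" for k
    using unit that by (simp_all add: u_def u'_def)
  have sgn: "(-1::real) ^ k = 1 \<or> (-1::real) ^ k = -1" for k by (cases "even k") auto
  \<comment> \<open>After the alternation, neighbouring normals coincide only if the original ones
    are opposite. Parallel neighbours with equal normals are allowed and become opposite.\<close>
  have du: "u k \<noteq> u (Suc k)" "u' k \<noteq> u' (Suc k)" if "k \<le> 4" for k
  proof -
    have "- n k \<noteq> n (Suc k)" "- n' k \<noteq> n' (Suc k)" using adj[OF that] by (metis minus_minus)+
    then show "u k \<noteq> u (Suc k)" "u' k \<noteq> u' (Suc k)"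
      using adj[OF that] sgn[of k] by (auto simp: u_def u'_def)
  qed
  have dt: "u i \<noteq> u' j" if "i \<le> 5" "j \<le> 5" for i j
  proof -
    have "- n i \<noteq> n' j" using trans[OF that] by (metis minus_minus)
    then show ?thesis using trans[OF that] sgn[of i] sgn[of j] by (auto simp: u_def u'_def)
  qed
  have par: "(-1::real) ^ i = (-1) ^ j" if "even (i + j)" for i j
    using that by (cases "even i") auto
  have FL: "F i j (L k) = (-1) ^ k * (n k \<bullet> c i j - h k) - (-1) ^ i * r i j" for i j k
    by (simp add: F_def L_def lift_def u_def g_def algebra_simps)
  have FM: "F i j (M k) = (-1) ^ k * (n' k \<bullet> c i j - h' k) - (-1) ^ i * r i j" for i j k
    by (simp add: F_def M_def lift_def u'_def g'_def algebra_simps)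
  have qq: "q (lift v x) (lift w y) = v \<bullet> w - 1" for v w x y by (simp add: q_def lift_def)
  have q_neq: "v \<bullet> w - 1 \<noteq> 0" if "norm v = 1" "norm w = 1" "v \<noteq> w" for v w :: "real^2"
  proof
    assume "v \<bullet> w - 1 = 0"
    then have "(v - w) \<bullet> (v - w) = 0"
      using unit_inner[OF that(1)] unit_inner[OF that(2)] by (simp add: inner_diff inner_commute)
    then show False using that by simp
  qed
  have F0: "F i j (L i) = 0" "F i j (L (Suc i)) = 0" "F i j (M j) = 0" "F i j (M (Suc j)) = 0"
    if "black i j" for i j
    using tang that par[of i j] unfolding FL FM by (simp_all add: black)
  \<comment> \<open>For these parities the oriented distance of line \<open>k\<close> has the sign
    opposite to that of the oriented radius, so the two cannot cancel.\<close>
  have FLa: "F i j (L k) \<noteq> 0"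
    if "black i j" "k \<le> 5" "Suc i < k \<and> even (i + k) \<or> k < i \<and> odd (i + k)" for i j k
    using that(3)
  proof
    assume "Suc i < k \<and> even (i + k)"
    then show ?thesis using away(2)[OF that(1), of k] r[OF that(1)] par[of i k] sgn[of i] that(2)
      unfolding FL by auto
  next
    assume *: "k < i \<and> odd (i + k)"
    then have "(-1::real) ^ i = - ((-1) ^ k)" by (cases "even i") auto
    then show ?thesis using away(1)[OF that(1), of k] r[OF that(1)] sgn[of k] *
      unfolding FL by auto
  qed
  have FMa: "F i j (M k) \<noteq> 0"
    if "black i j" "k \<le> 5" "Suc j < k \<and> even (j + k) \<or> k < j \<and> odd (j + k)" for i j k
    using that(3)
  proof
    assume *: "Suc j < k \<and> even (j + k)"
    then have "even (i + k)" using that(1) by (auto simp: black)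
    then show ?thesis using away(4)[OF that(1), of k] r[OF that(1)] par[of i k] sgn[of i] that(2) *
      unfolding FM by auto
  next
    assume *: "k < j \<and> odd (j + k)"
    then have "odd (i + k)" using that(1) by (auto simp: black)
    then have "(-1::real) ^ i = - ((-1) ^ k)" by (cases "even i") auto
    then show ?thesis using away(3)[OF that(1), of k] r[OF that(1)] sgn[of k] *
      unfolding FM by auto
  qed
  have meet: "\<exists>\<alpha> \<beta> \<gamma> \<delta>. \<alpha> \<noteq> 0 \<and> \<beta> \<noteq> 0 \<and> \<gamma> \<noteq> 0 \<and> \<delta> \<noteq> 0 \<and>
      \<alpha> *\<^sub>R L i + \<beta> *\<^sub>R L (Suc i) = \<gamma> *\<^sub>R M j + \<delta> *\<^sub>R M (Suc j)" if "black i j" for i j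
  proof -
    have ij: "i \<le> 4" "j \<le> 4" using that by (auto simp: black)
    have "u i \<bullet> c i j - (-1) ^ i * r i j = g i"
        "u (Suc i) \<bullet> c i j - (-1) ^ i * r i j = g (Suc i)"
        "u' j \<bullet> c i j - (-1) ^ i * r i j = g' j"
        "u' (Suc j) \<bullet> c i j - (-1) ^ i * r i j = g' (Suc j)"
      using F0[OF that] by (simp_all add: F_def L_def M_def lift_def)
    then show ?thesis
      unfolding L_def M_def
      by (intro lift_meet) (use ij nu du(1)[OF ij(1)] du(2)[OF ij(2)] dt[of i j] dt[of i "Suc j"]
          dt[of "Suc i" j] dt[of "Suc i" "Suc j"] in simp_all)
  qed
  define \<phi> where "\<phi> = corner_flip a"
  define \<psi> where "\<psi> = corner_flip b"
  define ci :: "nat \<Rightarrow> nat" where "ci i = (if a = 4 then i else 4 - i)" for i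
  define cj :: "nat \<Rightarrow> nat" where "cj j = (if b = 4 then j else 4 - j)" for j
  have fl: "\<phi> i \<le> 5" "\<psi> i \<le> 5" if "i \<le> 5" for i
    using that by (auto simp: \<phi>_def \<psi>_def corner_flip_def)
  \<comment> \<open>Reversal exchanges the two lines bounding a cell, whence the two
    alternatives.\<close>
  have phi: "\<phi> i = ci i \<and> \<phi> (Suc i) = Suc (ci i) \<or> \<phi> i = Suc (ci i) \<and> \<phi> (Suc i) = ci i"
       "ci i \<le> 4" if "i \<le> 4" for i
    using that by (auto simp: \<phi>_def ci_def corner_flip_def)
  have psi: "\<psi> i = cj i \<and> \<psi> (Suc i) = Suc (cj i) \<or> \<psi> i = Suc (cj i) \<and> \<psi> (Suc i) = cj i"
       "cj i \<le> 4" if "i \<le> 4" for i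
    using that by (auto simp: \<psi>_def cj_def corner_flip_def)
  have bl: "black (ci i) (cj j)" if "known_cell i j" for i j
    using that a b by (auto simp: black known_cell_def ci_def cj_def)
  have kle: "i \<le> 4 \<and> j \<le> 4" if "known_cell i j" for i j using that by (simp add: known_cell_def)
  \<comment> \<open>Reversal exchanges the two alternatives: \<open>5 - k < 4 - i\<close> iff
    \<open>Suc i < k\<close>, and (4 - i) + (5 - k) has the parity opposite to that of i +
    k.\<close>
  have awayphi: "Suc (ci i) < \<phi> k \<and> even (ci i + \<phi> k) \<or> \<phi> k < ci i \<and> odd (ci i + \<phi> k)"
    if "i \<le> 4" "k \<le> 5" "Suc i < k \<and> even (i + k) \<or> k < i \<and> odd (i + k)" for i k
    using that by (auto simp: \<phi>_def ci_def corner_flip_def)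
  have awaypsi: "Suc (cj i) < \<psi> k \<and> even (cj i + \<psi> k) \<or> \<psi> k < cj i \<and> odd (cj i + \<psi> k)"
    if "i \<le> 4" "k \<le> 5" "Suc i < k \<and> even (i + k) \<or> k < i \<and> odd (i + k)" for i k
    using that by (auto simp: \<psi>_def cj_def corner_flip_def)
  interpret C: checkerboard q "\<lambda>k. L (\<phi> k)" "\<lambda>k. M (\<psi> k)" "\<lambda>i j. F (ci i) (cj j)"
  proof
    show "bilinear q"
      by (auto simp: bilinear_def linear_iff q_def algebra_simps)
    show "q x y = q y x" for x y by (simp add: q_def inner_commute)
    show "q (L (\<phi> i)) (L (\<phi> i)) = 0" if "i \<le> 5" for i
      using unit_inner[OF nu(1)[OF fl(1)[OF that]]] by (simp add: L_def qq)
    show "q (M (\<psi> i)) (M (\<psi> i)) = 0" if "i \<le> 5" for i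
      using unit_inner[OF nu(2)[OF fl(2)[OF that]]] by (simp add: M_def qq)
    show "q (L (\<phi> i)) (L (\<phi> (Suc i))) \<noteq> 0" if "i \<le> 4" for i
      unfolding L_def qq by (rule q_neq) (use phi[OF that] nu du(1)[OF phi(2)[OF that]] in auto)
    show "q (M (\<psi> i)) (M (\<psi> (Suc i))) \<noteq> 0" if "i \<le> 4" for i
      unfolding M_def qq by (rule q_neq) (use psi[OF that] nu du(2)[OF psi(2)[OF that]] in auto)
    show "F (ci i) (cj j) (x + y) = F (ci i) (cj j) x + F (ci i) (cj j) y"
         "F (ci i) (cj j) (t *\<^sub>R x) = t *\<^sub>R F (ci i) (cj j) x" for i j x y t
      by (auto simp: F_def algebra_simps split: prod.splits)
    show "F (ci i) (cj j) (L (\<phi> i)) = 0 \<and> F (ci i) (cj j) (L (\<phi> (Suc i))) = 0" if "known_cell i j" for i j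
      using F0[OF bl[OF that]] phi(1)[of i] kle[OF that] by auto
    show "F (ci i) (cj j) (M (\<psi> j)) = 0 \<and> F (ci i) (cj j) (M (\<psi> (Suc j))) = 0" if "known_cell i j" for i j
      using F0[OF bl[OF that]] psi(1)[of j] kle[OF that] by auto
    show "F (ci i) (cj j) (L (\<phi> k)) \<noteq> 0" if "known_cell i j" "k \<le> 5"
        "Suc i < k \<and> even (i + k) \<or> k < i \<and> odd (i + k)" for i j k
      using FLa[OF bl[OF that(1)] fl(1)[OF that(2)]] awayphi[OF _ that(2,3)] kle[OF that(1)] by blast
    show "F (ci i) (cj j) (M (\<psi> k)) \<noteq> 0" if "known_cell i j" "k \<le> 5"
        "Suc j < k \<and> even (j + k) \<or> k < j \<and> odd (j + k)" for i j k
      using FMa[OF bl[OF that(1)] fl(2)[OF that(2)]] awaypsi[OF _ that(2,3)] kle[OF that(1)] by blast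
    show "\<exists>\<alpha> \<beta> \<gamma> \<delta>. \<alpha> \<noteq> 0 \<and> \<beta> \<noteq> 0 \<and> \<gamma> \<noteq> 0 \<and> \<delta> \<noteq> 0 \<and>
        \<alpha> *\<^sub>R L (\<phi> i) + \<beta> *\<^sub>R L (\<phi> (Suc i)) = \<gamma> *\<^sub>R M (\<psi> j) + \<delta> *\<^sub>R M (\<psi> (Suc j))"
      if "known_cell i j" for i j
      using meet[OF bl[OF that]] phi(1)[of i] psi(1)[of j] kle[OF that] by (metis add.commute)
  qed
  have a4: "ci 4 = a" "cj 4 = b" using a b by (auto simp: ci_def cj_def)
  obtain x where x: "x \<noteq> 0" "x \<in> C.A 4" "x \<in> C.B 4" using C.corner_meets by blast
  have "x \<in> span {L a, L (Suc a)}" "x \<in> span {M b, M (Suc b)}"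
    using x phi(1)[of 4] psi(1)[of 4] a4 by (auto simp: C.A_def C.B_def insert_commute)
  then obtain \<alpha> \<beta> \<gamma> \<delta> where
    "x = \<alpha> *\<^sub>R L a + \<beta> *\<^sub>R L (Suc a)" "x = \<gamma> *\<^sub>R M b + \<delta> *\<^sub>R M (Suc b)"
    unfolding span_pair_iff by blast
  then have eq: "\<alpha> *\<^sub>R L a + \<beta> *\<^sub>R L (Suc a) = \<gamma> *\<^sub>R M b + \<delta> *\<^sub>R M (Suc b)"
    and nz: "\<alpha> *\<^sub>R L a + \<beta> *\<^sub>R L (Suc a) \<noteq> 0" using x(1) by auto
  \<comment> \<open>As \<open>a\<close> and \<open>b\<close> are even, the alternation fixes the
    normals of lines \<open>a\<close>, \<open>b\<close> and reverses those of their successors; this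
    produces the signs in the conclusion.\<close>
  have ab: "a \<le> 4" "b \<le> 4" "even a" "even b" using a b by auto
  obtain p s where "u a \<bullet> p - s = g a" "u (Suc a) \<bullet> p - s = g (Suc a)"
      "u' b \<bullet> p - s = g' b" "u' (Suc b) \<bullet> p - s = g' (Suc b)"
    using meet_imp_circle[OF _ _ _ _ _ _ eq[unfolded L_def M_def] nz[unfolded L_def]]
      nu du[of a] dt[of a b] dt[of "Suc a" b] ab by auto
  then show ?thesis using ab by (intro exI[of _ p] exI[of _ s]) (simp add: u_def u'_def g_def g'_def)
qed

section \<open>Circles inscribed in convex quadrilaterals\<close>

text \<open>For \<open>x = A + t *\<^sub>R (B - A)\<close>, the side condition whose boundary passes
  through \<open>A\<close> gives \<open>0 \<le> t\<close>, and the one through \<open>B\<close>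
  gives \<open>t \<le> 1\<close>.\<close>

lemma segment_on_line:
  fixes n n' n'' A B x :: "real^2"
  assumes "n \<noteq> 0" "n \<bullet> A = h" "n \<bullet> B = h" "n \<bullet> x = h"
    and "n' \<bullet> A = h'" "n' \<bullet> B > h'" "n'' \<bullet> A > h''" "n'' \<bullet> B = h''"
    and "n' \<bullet> x \<ge> h'" "n'' \<bullet> x \<ge> h''"
  shows "x \<in> closed_segment A B"
proof -
  have "B - A \<noteq> 0" using assms(5,6) by auto
  then obtain t where t: "x - A = t *\<^sub>R (B - A)"
    using orthogonal_parallel[of n "B - A" "x - A"] assms by (auto simp: inner_diff_right)
  then have x: "x = A + t *\<^sub>R (B - A)" by (simp add: algebra_simps)
  have "n' \<bullet> x - h' = t * (n' \<bullet> B - h')" "n'' \<bullet> x - h'' = (1 - t) * (n'' \<bullet> A - h'')"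
    unfolding x using assms(5,8) by (simp_all add: inner_add_right inner_diff_right algebra_simps)
  then have "0 \<le> t * (n' \<bullet> B - h')" "0 \<le> (1 - t) * (n'' \<bullet> A - h'')" using assms(9,10) by simp_all
  then have "0 \<le> t" "t \<le> 1" using assms(6,7) by (simp_all add: zero_le_mult_iff)
  then show ?thesis unfolding x closed_segment_def by (force simp: algebra_simps)
qed

lemma norm_square_shift_unit:
  assumes "norm n = 1"
  shows "(y + t *\<^sub>R n) \<bullet> (y + t *\<^sub>R n) = y \<bullet> y + 2 * t * (n \<bullet> y) + t * t"
proof -
  have "n \<bullet> n = 1" using assms by (simp add: norm_eq_1)
  then show ?thesis
    using inner_commute[of y n] by (simp add: inner_add_left inner_add_right distrib_left)
qed

lemma touches_sideI:
  fixes n c :: "real^2"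
  assumes "norm n = 1" "n \<bullet> A = h" "n \<bullet> B = h" "n \<bullet> c - h = r" "0 < r"
    and "c - r *\<^sub>R n \<in> closed_segment A B"
  shows "touches_side c r A B"
  unfolding touches_side_def
proof (rule bexI[OF _ assms(6)])
  have "x = c - r *\<^sub>R n" if x: "x \<in> affine hull {A, B}" "dist c x = r" for x
  proof -
    obtain u v where "x = u *\<^sub>R A + v *\<^sub>R B" "u + v = 1" using x(1) by (auto simp: affine_hull_2)
    then have "n \<bullet> x = (u + v) * h" using assms(2,3) by (simp add: inner_add_right flip: distrib_right)
    then have nx: "n \<bullet> x = h" using \<open>u + v = 1\<close> by simp
    have "(x - c) \<bullet> (x - c) = r * r"
      using x(2) by (simp add: dist_norm norm_minus_commute dot_square_norm power2_eq_square)
    moreover have "n \<bullet> (x - c) = - r" using nx assms(4) by (simp add: inner_diff_right)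
    ultimately have "(x - c + r *\<^sub>R n) \<bullet> (x - c + r *\<^sub>R n) = 0"
      unfolding norm_square_shift_unit[OF assms(1)] by simp
    then have "x - c + r *\<^sub>R n = 0" by simp
    then show ?thesis by (simp add: algebra_simps)
  qed
  moreover have "c - r *\<^sub>R n \<in> affine hull {A, B}"
    using assms(6) segment_convex_hull convex_hull_subset_affine_hull by blast
  moreover have "dist c (c - r *\<^sub>R n) = r" using assms(1,5) by (simp add: dist_norm)
  ultimately show "affine hull {A, B} \<inter> sphere c r = {c - r *\<^sub>R n}"
    unfolding sphere_def by blast
qed

text \<open>Reflecting the point of contact in the foot of the perpendicular from \<open>c\<close>
  gives another common point of line and circle. By uniqueness the point of contact is the foot. The
  absolute value leaves open on which side \<open>c\<close> lies.\<close>

lemma touches_sideD: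
  fixes n c A B :: "real^2"
  assumes "touches_side c r A B" "norm n = 1" "n \<bullet> A = h" "n \<bullet> B = h" "A \<noteq> B" "0 < r"
  shows "\<bar>n \<bullet> c - h\<bar> = r"
proof -
  obtain T where T: "affine hull {A, B} \<inter> sphere c r = {T}"
    using assms(1) by (auto simp: touches_side_def)
  have nn: "n \<bullet> n = 1" using unit_inner assms(2) .
  define d where "d = n \<bullet> c - h"
  have "n \<noteq> 0" using assms(2) by auto
  have hull: "x \<in> affine hull {A, B}" if nx: "n \<bullet> x = h" for x
  proof -
    obtain t where "x - A = t *\<^sub>R (B - A)"
      using orthogonal_parallel[of n "B - A" "x - A"] \<open>n \<noteq> 0\<close> assms nx by (auto simp: inner_diff_right)
    then have "x = A + t *\<^sub>R (B - A)" by (simp add: algebra_simps)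
    then show ?thesis unfolding affine_hull_2_alt by blast
  qed
  have TT: "T \<in> affine hull {A, B}" "dist c T = r" using T by auto
  then obtain u v where uv: "T = u *\<^sub>R A + v *\<^sub>R B" "u + v = 1" by (auto simp: affine_hull_2)
  then have "n \<bullet> T = (u + v) * h" using assms(3,4) by (simp add: inner_add_right flip: distrib_right)
  then have nT: "n \<bullet> T = h" using uv by simp
  define T' where "T' = 2 *\<^sub>R (c - d *\<^sub>R n) - T"
  have "n \<bullet> T' = h" using nT by (simp add: T'_def inner_diff_right nn d_def)
  moreover have "dist c T' = r"
  proof -
    have "(T' - c) \<bullet> (T' - c) = (T - c) \<bullet> (T - c)"
    proof -
      have "T' - c = - ((T - c) + (2 * d) *\<^sub>R n)" by (simp add: T'_def algebra_simps scaleR_2)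
      then have "(T' - c) \<bullet> (T' - c) = ((T - c) + (2 * d) *\<^sub>R n) \<bullet> ((T - c) + (2 * d) *\<^sub>R n)"
        by (simp only: inner_minus_left inner_minus_right minus_minus)
      also have "\<dots> = (T - c) \<bullet> (T - c) + 4 * d * (n \<bullet> (T - c)) + 4 * d * d"
        unfolding norm_square_shift_unit[OF assms(2)] by simp
      finally have "(T' - c) \<bullet> (T' - c) = (T - c) \<bullet> (T - c) + 4 * d * (n \<bullet> (T - c)) + 4 * d * d" .
      then show ?thesis using nT by (simp add: inner_diff_right d_def algebra_simps)
    qed
    then have "norm (T' - c) = norm (T - c)" by (simp add: norm_eq_sqrt_inner)
    then show ?thesis using TT by (simp add: dist_norm norm_minus_commute)
  qed
  ultimately have "T' = T" using T hull by auto
  then have "2 *\<^sub>R T = 2 *\<^sub>R (c - d *\<^sub>R n)" by (simp add: T'_def scaleR_2 algebra_simps)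
  then have "T = c - d *\<^sub>R n" by simp
  then have "dist c T = \<bar>d\<bar>" using assms(2) by (simp add: dist_norm)
  then show ?thesis using TT by (simp add: d_def)
qed

text \<open>The containment of the disc is kept only as the position of its centre, which later
  fixes the signs of the distances to the grid lines.\<close>

lemma circumscribedD:
  assumes "circumscribed A B C D"
  obtains c r where "0 < r" "c \<in> convex hull {A, B, C, D}"
    "touches_side c r A B" "touches_side c r B C" "touches_side c r C D" "touches_side c r D A"
proof -
  obtain c r where c: "0 < r" "cball c r \<subseteq> quad_region A B C D"
    "touches_side c r A B" "touches_side c r B C" "touches_side c r C D" "touches_side c r D A"
    using assms unfolding circumscribed_def by blast
  have *: "quad_boundary A B C D \<subseteq> convex hull {A, B, C, D}"
    unfolding quad_boundary_def segment_convex_hull by (intro Un_least hull_mono) auto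
  have "quad_region A B C D \<subseteq> convex hull {A, B, C, D}"
    unfolding quad_region_def using * inside_mono[OF *] inside_convex[OF convex_convex_hull] by blast
  moreover have "c \<in> cball c r" using c(1) by simp
  ultimately show thesis using that c by blast
qed

section \<open>Inner normals and the incircle of a convex quadrilateral\<close>

definition rot :: "real^2 \<Rightarrow> real^2" where "rot v = vector [- v $ 2, v $ 1]"

lemma rot_inner: "rot u \<bullet> v = cross2 u v"
  by (simp add: rot_def inner_real2 cross2_def)

lemma rot_parallel:
  assumes "norm n = 1" "n \<bullet> u = 0"
  shows "\<exists>t. rot u = t *\<^sub>R n"
proof (rule cross2_parallel)
  show "n \<noteq> 0" using assms by auto
  show "cross2 n (rot u) = 0"
    using assms(2) by (simp add: rot_def inner_real2 cross2_def algebra_simps)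
qed

text \<open>Rotating the edges of a closed polygon by a right angle gives a linear relation between
  its normals; for a convex quadrilateral the coefficients have the same sign.\<close>

lemma normals_relation:
  fixes A B C D n1 n2 n3 n4 :: "real^2"
  assumes unit: "norm n1 = 1" "norm n2 = 1" "norm n3 = 1" "norm n4 = 1"
    and 1: "n1 \<bullet> A = h1" "n1 \<bullet> B = h1" "n1 \<bullet> C > h1" "n1 \<bullet> D > h1"
    and 2: "n2 \<bullet> B = h2" "n2 \<bullet> C = h2" "n2 \<bullet> D > h2" "n2 \<bullet> A > h2"
    and 3: "n3 \<bullet> C = h3" "n3 \<bullet> D = h3" "n3 \<bullet> A > h3" "n3 \<bullet> B > h3"
    and 4: "n4 \<bullet> D = h4" "n4 \<bullet> A = h4" "n4 \<bullet> B > h4" "n4 \<bullet> C > h4"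
  shows "\<exists>a b c d. 0 < a \<and> 0 < b \<and> 0 < c \<and> 0 < d \<and>
    a *\<^sub>R n1 + b *\<^sub>R n2 + c *\<^sub>R n3 + d *\<^sub>R n4 = 0"
proof -
  obtain a where a: "rot (B - A) = a *\<^sub>R n1"
    using rot_parallel[OF unit(1), of "B - A"] 1 by (auto simp: inner_diff_right)
  obtain b where b: "rot (C - B) = b *\<^sub>R n2"
    using rot_parallel[OF unit(2), of "C - B"] 2 by (auto simp: inner_diff_right)
  obtain c where c: "rot (D - C) = c *\<^sub>R n3"
    using rot_parallel[OF unit(3), of "D - C"] 3 by (auto simp: inner_diff_right)
  obtain d where d: "rot (A - D) = d *\<^sub>R n4"
    using rot_parallel[OF unit(4), of "A - D"] 4 by (auto simp: inner_diff_right)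
  have "rot (B - A) + rot (C - B) + rot (D - C) + rot (A - D) = 0"
    by (simp add: rot_def vec_eq_iff forall_2)
  then have sum: "a *\<^sub>R n1 + b *\<^sub>R n2 + c *\<^sub>R n3 + d *\<^sub>R n4 = 0" by (simp add: a b c d)
  have "a \<noteq> 0"
  proof
    assume "a = 0"
    then have "rot (B - A) = 0" using a by simp
    then have "A = B" by (simp add: rot_def vec_eq_iff forall_2)
    then show False using 4 by auto
  qed
  \<comment> \<open>Both sides are the cross product of the two edges at \<open>Q\<close>. Hence
    neighbouring coefficients agree up to positive factors, and all four have the same sign.\<close>
  have key: "rot (Q - P) \<bullet> (R - Q) = rot (R - Q) \<bullet> (P - Q)" for P Q R
    by (simp add: rot_inner cross2_def algebra_simps)
  have "a * (n1 \<bullet> (C - B)) = b * (n2 \<bullet> (A - B))" using key[of B A C] by (simp add: a b)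
  then have ab: "a * (n1 \<bullet> C - h1) = b * (n2 \<bullet> A - h2)" using 1 2 by (simp add: inner_diff_right)
  have "b * (n2 \<bullet> (D - C)) = c * (n3 \<bullet> (B - C))" using key[of C B D] by (simp add: b c)
  then have bc: "b * (n2 \<bullet> D - h2) = c * (n3 \<bullet> B - h3)" using 2 3 by (simp add: inner_diff_right)
  have "c * (n3 \<bullet> (A - D)) = d * (n4 \<bullet> (C - D))" using key[of D C A] by (simp add: c d)
  then have cd: "c * (n3 \<bullet> A - h3) = d * (n4 \<bullet> C - h4)" using 3 4 by (simp add: inner_diff_right)
  have sg: "(0 < s \<longleftrightarrow> 0 < t) \<and> (s < 0 \<longleftrightarrow> t < 0)" if "s * p = t * q" "0 < p" "0 < q" for s t p q :: real
    using that by (metis mult_less_0_iff not_less_iff_gr_or_eq zero_less_mult_iff)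
  have same: "(0 < a \<longleftrightarrow> 0 < b) \<and> (a < 0 \<longleftrightarrow> b < 0)" "(0 < b \<longleftrightarrow> 0 < c) \<and> (b < 0 \<longleftrightarrow> c < 0)"
    "(0 < c \<longleftrightarrow> 0 < d) \<and> (c < 0 \<longleftrightarrow> d < 0)"
    by (rule sg[OF ab] sg[OF bc] sg[OF cd]; use 1 2 3 4 in simp)+
  show ?thesis
  proof (cases "0 < a")
    case True
    then show ?thesis using sum same by blast
  next
    case False
    then have neg: "0 < -a" "0 < -b" "0 < -c" "0 < -d" using same \<open>a \<noteq> 0\<close> by auto
    have "(-a) *\<^sub>R n1 + (-b) *\<^sub>R n2 + (-c) *\<^sub>R n3 + (-d) *\<^sub>R n4 =
        - (a *\<^sub>R n1 + b *\<^sub>R n2 + c *\<^sub>R n3 + d *\<^sub>R n4)" by simp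
    then show ?thesis using neg sum by (metis neg_equal_0_iff_equal)
  qed
qed

text \<open>The relation between the inner normals makes a positively weighted sum of the distances
  to the sides constant and positive. This gives \<open>0 < s\<close> and bounds the intersection of
  the half-planes, which can then be identified with the region of the quadrilateral.\<close>

lemma circumscribedI:
  fixes A B C D n1 n2 n3 n4 :: "real^2"
  assumes unit: "norm n1 = 1" "norm n2 = 1" "norm n3 = 1" "norm n4 = 1"
    and 1: "n1 \<bullet> A = h1" "n1 \<bullet> B = h1" "n1 \<bullet> C > h1" "n1 \<bullet> D > h1"
    and 2: "n2 \<bullet> B = h2" "n2 \<bullet> C = h2" "n2 \<bullet> D > h2" "n2 \<bullet> A > h2"
    and 3: "n3 \<bullet> C = h3" "n3 \<bullet> D = h3" "n3 \<bullet> A > h3" "n3 \<bullet> B > h3"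
    and 4: "n4 \<bullet> D = h4" "n4 \<bullet> A = h4" "n4 \<bullet> B > h4" "n4 \<bullet> C > h4"
    and p: "n1 \<bullet> p - h1 = s" "n2 \<bullet> p - h2 = s" "n3 \<bullet> p - h3 = s" "n4 \<bullet> p - h4 = s"
  shows "circumscribed A B C D"
proof -
  obtain a b c d where pos: "0 < a" "0 < b" "0 < c" "0 < d"
      and rel: "a *\<^sub>R n1 + b *\<^sub>R n2 + c *\<^sub>R n3 + d *\<^sub>R n4 = 0"
    using normals_relation[OF unit 1 2 3 4] by blast
  define S where "S = - (a * h1 + b * h2 + c * h3 + d * h4)"
  have const: "a * (n1 \<bullet> x - h1) + b * (n2 \<bullet> x - h2) + c * (n3 \<bullet> x - h3) + d * (n4 \<bullet> x - h4) = S" for x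
  proof -
    have "(a *\<^sub>R n1 + b *\<^sub>R n2 + c *\<^sub>R n3 + d *\<^sub>R n4) \<bullet> x = 0" using rel by simp
    then show ?thesis by (simp add: S_def inner_add_left algebra_simps)
  qed
  \<comment> \<open>At the vertex \<open>A\<close> the first and fourth distances vanish and the
    other two are positive.\<close>
  have "0 < b * (n2 \<bullet> A - h2)" "0 < c * (n3 \<bullet> A - h3)" using pos 2 3 by simp_all
  then have "0 < S" using const[of A] 1 4 by simp
  moreover have "(a + b + c + d) * s = S" using const[of p] p by (simp add: algebra_simps)
  ultimately have "0 < s" using pos by (metis add_pos_pos zero_less_mult_pos)

  define K where "K = {x. n1 \<bullet> x \<ge> h1} \<inter> {x. n2 \<bullet> x \<ge> h2} \<inter> {x. n3 \<bullet> x \<ge> h3} \<inter> {x. n4 \<bullet> x \<ge> h4}"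
  have "convex K" unfolding K_def by (intro convex_Int convex_halfspace_ge)
  have "closed K" unfolding K_def by (intro closed_Int closed_halfspace_ge)
  have on_AB: "x \<in> closed_segment A B" if "x \<in> K" "n1 \<bullet> x = h1" for x
    using segment_on_line[where n=n1 and n'=n4 and n''=n2 and A=A and B=B
        and x=x and h=h1 and h'=h4 and h''=h2] that 1 2 4 unit by (force simp: K_def)
  have on_BC: "x \<in> closed_segment B C" if "x \<in> K" "n2 \<bullet> x = h2" for x
    using segment_on_line[where n=n2 and n'=n1 and n''=n3 and A=B and B=C
        and x=x and h=h2 and h'=h1 and h''=h3] that 1 2 3 unit by (force simp: K_def)
  have on_CD: "x \<in> closed_segment C D" if "x \<in> K" "n3 \<bullet> x = h3" for x
    using segment_on_line[where n=n3 and n'=n2 and n''=n4 and A=C and B=D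
        and x=x and h=h3 and h'=h2 and h''=h4] that 2 3 4 unit by (force simp: K_def)
  have on_DA: "x \<in> closed_segment D A" if "x \<in> K" "n4 \<bullet> x = h4" for x
    using segment_on_line[where n=n4 and n'=n3 and n''=n1 and A=D and B=A
        and x=x and h=h4 and h'=h3 and h''=h1] that 1 3 4 unit by (force simp: K_def)
  \<comment> \<open>Each weighted distance is at most \<open>S\<close> on \<open>K\<close>, and the
    coordinates given by the independent normals \<open>n1\<close>, \<open>n4\<close> control the
    norm.\<close>
  have "bounded K"
  proof -
    define f where "f = (\<lambda>x. (n1 \<bullet> x, n4 \<bullet> x))"
    have lin: "linear f" unfolding f_def by (auto simp: linear_iff inner_add_right)
    have "x = 0" if "f x = 0" for x
    proof -
      have *: "n1 \<bullet> x = 0" "n4 \<bullet> x = 0" using that by (auto simp: f_def zero_prod_def)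
      have "B - A \<noteq> 0" "n1 \<bullet> (B - A) = 0" "n4 \<bullet> (B - A) > 0" using 1 4 by (auto simp: inner_diff_right)
      moreover have "n1 \<noteq> 0" using unit by auto
      ultimately obtain t where "x = t *\<^sub>R (B - A)"
        using orthogonal_parallel[of n1 "B - A" x] * by auto
      then show "x = 0" using * \<open>n4 \<bullet> (B - A) > 0\<close> by auto
    qed
    then have "inj f" using linear_injective_0[OF lin] by blast
    then obtain e where e: "e > 0" "\<And>x. e * norm x \<le> norm (f x)"
      using linear_inj_bounded_below_pos[OF lin] by blast
    have "norm x \<le> ((\<bar>h1\<bar> + S / a) + (\<bar>h4\<bar> + S / d)) / e" if "x \<in> K" for x
    proof -
      have nn: "0 \<le> a * (n1 \<bullet> x - h1)" "0 \<le> b * (n2 \<bullet> x - h2)" "0 \<le> c * (n3 \<bullet> x - h3)" "0 \<le> d * (n4 \<bullet> x - h4)"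
        using that pos by (auto simp: K_def)
      then have "a * (n1 \<bullet> x - h1) \<le> S" "d * (n4 \<bullet> x - h4) \<le> S" using const[of x] by linarith+
      then have "n1 \<bullet> x - h1 \<le> S / a" "n4 \<bullet> x - h4 \<le> S / d" using pos by (simp_all add: field_simps)
      moreover have "n1 \<bullet> x \<ge> h1" "n4 \<bullet> x \<ge> h4" using that by (auto simp: K_def)
      ultimately have "\<bar>n1 \<bullet> x\<bar> \<le> \<bar>h1\<bar> + S / a" "\<bar>n4 \<bullet> x\<bar> \<le> \<bar>h4\<bar> + S / d" by linarith+
      moreover have "norm (f x) \<le> \<bar>n1 \<bullet> x\<bar> + \<bar>n4 \<bullet> x\<bar>"
        unfolding f_def norm_Pair by (simp add: real_sqrt_sum_squares_triangle_ineq sqrt_sum_squares_le_sum_abs)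
      ultimately have "e * norm x \<le> (\<bar>h1\<bar> + S / a) + (\<bar>h4\<bar> + S / d)" using e(2)[of x] by linarith
      then show ?thesis using e(1) by (simp add: field_simps)
    qed
    then show ?thesis unfolding bounded_iff by blast
  qed
  have bd_sub: "quad_boundary A B C D \<subseteq> K"
  proof -
    have "A \<in> K" "B \<in> K" "C \<in> K" "D \<in> K" using 1 2 3 4 by (auto simp: K_def)
    then show ?thesis unfolding quad_boundary_def
      using \<open>convex K\<close> by (simp add: closed_segment_subset)
  qed
  have bd: "x \<in> quad_boundary A B C D \<longleftrightarrow>
      x \<in> K \<and> (n1 \<bullet> x = h1 \<or> n2 \<bullet> x = h2 \<or> n3 \<bullet> x = h3 \<or> n4 \<bullet> x = h4)" for x
  proof
    assume x: "x \<in> quad_boundary A B C D"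
    have on: "n \<bullet> x = h" if "x \<in> closed_segment P Q" "n \<bullet> P = h" "n \<bullet> Q = h" for n P Q and h :: real
      using that by (auto simp: closed_segment_def inner_add_right left_diff_distrib)
    show "x \<in> K \<and> (n1 \<bullet> x = h1 \<or> n2 \<bullet> x = h2 \<or> n3 \<bullet> x = h3 \<or> n4 \<bullet> x = h4)"
      using x bd_sub on 1 2 3 4 unfolding quad_boundary_def by blast
  qed (use on_AB on_BC on_CD on_DA in \<open>auto simp: quad_boundary_def\<close>)
  have int: "interior K = {x. n1 \<bullet> x > h1} \<inter> {x. n2 \<bullet> x > h2} \<inter> {x. n3 \<bullet> x > h3} \<inter> {x. n4 \<bullet> x > h4}"
  proof -
    have "n1 \<noteq> 0" "n2 \<noteq> 0" "n3 \<noteq> 0" "n4 \<noteq> 0" using unit by auto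
    then show ?thesis by (simp add: K_def interior_halfspace_ge)
  qed
  have "frontier K = quad_boundary A B C D"
    unfolding frontier_def closure_closed[OF \<open>closed K\<close>] int
    by (auto simp: bd) (auto simp: K_def)
  then have region: "K \<subseteq> quad_region A B C D"
    using inside_frontier_eq_interior[OF \<open>bounded K\<close> \<open>convex K\<close>] interior_subset
      closure_closed[OF \<open>closed K\<close>]
    by (auto simp: quad_region_def frontier_def)
  have "cball p s \<subseteq> K"
  proof
    fix x assume "x \<in> cball p s"
    then have "norm (p - x) \<le> s" by (simp add: dist_norm)
    then have "n \<bullet> p - n \<bullet> x \<le> s" if "norm n = 1" for n
      using Cauchy_Schwarz_ineq2[of n "p - x"] that by (simp add: inner_diff_right)
    then have "n \<bullet> x \<ge> h" if "norm n = 1" "n \<bullet> p - h = s" for n h using that by fastforce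
    then show "x \<in> K" using unit p by (auto simp: K_def)
  qed
  \<comment> \<open>The feet of the perpendiculars lie in the disc, hence in \<open>K\<close>, so
    they are on the sides and not on extensions.\<close>
  have foot: "p - s *\<^sub>R n \<in> K" if "norm n = 1" for n
  proof -
    have "p - s *\<^sub>R n \<in> cball p s" using that \<open>0 < s\<close> by (simp add: dist_norm)
    then show ?thesis using \<open>cball p s \<subseteq> K\<close> by blast
  qed
  have foot_on: "n \<bullet> (p - s *\<^sub>R n) = h" if "norm n = 1" "n \<bullet> p - h = s" for n h
    using that unit_inner[OF that(1)] by (simp add: inner_diff_right)
  show ?thesis
    unfolding circumscribed_def
  proof (intro exI conjI)
    show "0 < s" "cball p s \<subseteq> quad_region A B C D" using \<open>0 < s\<close> \<open>cball p s \<subseteq> K\<close> region by auto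
    show "touches_side p s A B"
      by (rule touches_sideI[OF unit(1) 1(1,2) p(1) \<open>0 < s\<close>]) (use on_AB foot foot_on unit p in blast)
    show "touches_side p s B C"
      by (rule touches_sideI[OF unit(2) 2(1,2) p(2) \<open>0 < s\<close>]) (use on_BC foot foot_on unit p in blast)
    show "touches_side p s C D"
      by (rule touches_sideI[OF unit(3) 3(1,2) p(3) \<open>0 < s\<close>]) (use on_CD foot foot_on unit p in blast)
    show "touches_side p s D A"
      by (rule touches_sideI[OF unit(4) 4(1,2) p(4) \<open>0 < s\<close>]) (use on_DA foot foot_on unit p in blast)
  qed
qed

section \<open>Normals of the grid lines\<close>

lemma line_normal:
  assumes "is_line L"
  obtains n h where "norm n = 1" "L = {x. n \<bullet> x = h}"
proof -
  have "affine L" "aff_dim L = DIM(real^2) - 1" using assms by (simp_all add: is_line_def)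
  then obtain a b where ab: "a \<noteq> 0" "L = {x. a \<bullet> x = b}"
    using aff_dim_eq_hyperplane[of L] affine_hull_eq[of L] by metis
  have "L = {x. (a /\<^sub>R norm a) \<bullet> x = b / norm a}"
    using ab by (auto simp: field_simps)
  then show thesis using that[of "a /\<^sub>R norm a"] ab(1) by simp
qed

text \<open>Makes every affine function along the segment a strictly monotone or constant function
  of the index.\<close>

lemma in_order_parameter:
  assumes "in_order X"
  obtains t where "\<And>a. a \<le> 5 \<Longrightarrow> X a = X 0 + t a *\<^sub>R (X 5 - X 0)"
    and "\<And>a b. a < b \<Longrightarrow> b \<le> 5 \<Longrightarrow> t a < (t b :: real)"
proof -
  have ord: "\<exists>s>0. s < 1 \<and> X j = X i + s *\<^sub>R (X k - X i)" if "i < j" "j < k" "k \<le> 5" for i j k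
  proof -
    have "X j \<in> open_segment (X i) (X k)" using assms that by (auto simp: in_order_def)
    then obtain s where "0 < s" "s < 1" "X j = (1 - s) *\<^sub>R X i + s *\<^sub>R X k"
      by (auto simp: in_segment)
    then show ?thesis by (intro exI[of _ s]) (simp add: algebra_simps)
  qed
  have "X 1 \<in> open_segment (X 0) (X 5)"
    using assms[unfolded in_order_def, rule_format, of 0 1 5] by simp
  then have ne: "X 5 - X 0 \<noteq> 0" by auto
  have "\<exists>s. a \<le> 5 \<longrightarrow> X a = X 0 + s *\<^sub>R (X 5 - X 0) \<and> (a = 0 \<longrightarrow> s = 0) \<and>
      (0 < a \<longrightarrow> 0 < s) \<and> (a < 5 \<longrightarrow> s < 1) \<and> (a = 5 \<longrightarrow> s = 1)" for a
  proof -
    consider "a = 0" | "a = 5" | "0 < a" "a < 5" | "5 < a" by linarith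
    then show ?thesis
    proof cases
      case 1 then show ?thesis by (intro exI[of _ 0]) simp
    next
      case 2 then show ?thesis by (intro exI[of _ 1]) simp
    next
      case 3 then show ?thesis using ord[of 0 a 5] by auto
    qed auto
  qed
  then obtain t where t: "\<And>a. a \<le> 5 \<Longrightarrow> X a = X 0 + t a *\<^sub>R (X 5 - X 0) \<and> (a = 0 \<longrightarrow> t a = 0) \<and>
      (0 < a \<longrightarrow> 0 < t a) \<and> (a < 5 \<longrightarrow> t a < 1) \<and> (a = 5 \<longrightarrow> t a = 1)"
    by metis
  have "t a < t b" if ab: "a < b" "b \<le> 5" for a b
  proof (cases "a = 0")
    case False
    then obtain s where s: "0 < s" "s < 1" "X a = X 0 + s *\<^sub>R (X b - X 0)"
      using ord[of 0 a b] ab by auto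
    have "X b - X 0 = t b *\<^sub>R (X 5 - X 0)" "X a - X 0 = t a *\<^sub>R (X 5 - X 0)"
      using t[of a] t[of b] that by (simp_all add: algebra_simps)
    moreover have "X a - X 0 = s *\<^sub>R (X b - X 0)" using s(3) by (metis add_diff_cancel_left')
    ultimately have "t a *\<^sub>R (X 5 - X 0) = (s * t b) *\<^sub>R (X 5 - X 0)" by (metis scaleR_scaleR)
    then have "t a = s * t b" using ne by (metis scaleR_cancel_right)
    moreover have "0 < t b" using t[of b] that by auto
    ultimately show ?thesis using s by simp
  qed (use t[of a] t[of b] that in auto)
  then show thesis using that t by blast
qed

lemma zero_on_segment:
  fixes n x y :: "'a::real_inner"
  assumes "n \<bullet> x < h" "h < n \<bullet> y"
  obtains z where "z \<in> closed_segment x y" "n \<bullet> z = h"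
proof -
  define t where "t = (h - n \<bullet> x) / (n \<bullet> y - n \<bullet> x)"
  have "0 \<le> t" "t \<le> 1" using assms by (simp_all add: t_def)
  then have "x + t *\<^sub>R (y - x) \<in> closed_segment x y"
    by (force simp: closed_segment_def algebra_simps)
  moreover have "n \<bullet> (x + t *\<^sub>R (y - x)) = h"
    using assms by (simp add: t_def inner_add_right inner_diff_right)
  ultimately show thesis using that by blast
qed

lemma segment_halfspace:
  fixes n x y z :: "'a::real_inner"
  assumes "z \<in> closed_segment x y"
  shows "h < n \<bullet> x \<Longrightarrow> h < n \<bullet> y \<Longrightarrow> h < n \<bullet> z" "n \<bullet> x < h \<Longrightarrow> n \<bullet> y < h \<Longrightarrow> n \<bullet> z < h"
    "n \<bullet> x = h \<Longrightarrow> n \<bullet> y = h \<Longrightarrow> n \<bullet> z = h"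
proof -
  have sub: "z \<in> S" if "x \<in> S" "y \<in> S" "convex S" for S
    using that assms closed_segment_subset by blast
  show "h < n \<bullet> x \<Longrightarrow> h < n \<bullet> y \<Longrightarrow> h < n \<bullet> z"
    using sub[of "{v. h < n \<bullet> v}"] convex_halfspace_gt[of h n] by simp
  show "n \<bullet> x < h \<Longrightarrow> n \<bullet> y < h \<Longrightarrow> n \<bullet> z < h"
    using sub[of "{v. n \<bullet> v < h}"] convex_halfspace_lt[of n h] by simp
  show "n \<bullet> x = h \<Longrightarrow> n \<bullet> y = h \<Longrightarrow> n \<bullet> z = h"
    using sub[of "{v. n \<bullet> v = h}"] convex_hyperplane[of n h] by simp
qed

text \<open>An affine function vanishing on \<open>L\<close> is monotone along both sequences and
  vanishes at index \<open>k\<close> of each. If it increased on one and decreased on the other, it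
  would vanish on the segment joining the ends \<open>X e\<close>, \<open>Y e\<close>, contrary to
  \<open>ends\<close>. The normal is reversed if both decrease.\<close>

lemma oriented_normal:
  assumes L: "is_line L" and X: "in_order X" and Y: "in_order Y" and k: "k \<le> 5"
    and XL: "X k \<in> L" "\<And>a. a \<le> 5 \<Longrightarrow> X a \<in> L \<Longrightarrow> X a = X k"
    and YL: "Y k \<in> L" "\<And>a. a \<le> 5 \<Longrightarrow> Y a \<in> L \<Longrightarrow> Y a = Y k"
    and ends: "\<And>e. e \<in> {0, 5} \<Longrightarrow> e \<noteq> k \<Longrightarrow> closed_segment (X e) (Y e) \<inter> L = {}"
  shows "\<exists>n h. norm n = 1 \<and> L = {x. n \<bullet> x = h} \<and>
    (\<forall>a\<le>5. (k < a \<longrightarrow> h < n \<bullet> X a \<and> h < n \<bullet> Y a) \<and> (a < k \<longrightarrow> n \<bullet> X a < h \<and> n \<bullet> Y a < h))"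
proof -
  obtain n h where n: "norm n = 1" "L = {x. n \<bullet> x = h}" using line_normal[OF L] .
  obtain t where t: "\<And>a. a \<le> 5 \<Longrightarrow> X a = X 0 + t a *\<^sub>R (X 5 - X 0)"
      "\<And>a b. a < b \<Longrightarrow> b \<le> 5 \<Longrightarrow> t a < (t b :: real)"
    using in_order_parameter[OF X] by metis
  obtain s where s: "\<And>a. a \<le> 5 \<Longrightarrow> Y a = Y 0 + s a *\<^sub>R (Y 5 - Y 0)"
      "\<And>a b. a < b \<Longrightarrow> b \<le> 5 \<Longrightarrow> s a < (s b :: real)"
    using in_order_parameter[OF Y] by metis
  define d where "d = n \<bullet> (X 5 - X 0)"
  define d' where "d' = n \<bullet> (Y 5 - Y 0)"
  have X': "n \<bullet> X a - h = (t a - t k) * d" if "a \<le> 5" for a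
  proof -
    have "n \<bullet> X a = n \<bullet> X 0 + t a * d" "n \<bullet> X k = n \<bullet> X 0 + t k * d"
      using t(1)[OF that] t(1)[OF k] by (metis d_def inner_add_right inner_scaleR_right)+
    then show ?thesis using XL(1) n(2) by (simp add: algebra_simps)
  qed
  have Y': "n \<bullet> Y a - h = (s a - s k) * d'" if "a \<le> 5" for a
  proof -
    have "n \<bullet> Y a = n \<bullet> Y 0 + s a * d'" "n \<bullet> Y k = n \<bullet> Y 0 + s k * d'"
      using s(1)[OF that] s(1)[OF k] by (metis d'_def inner_add_right inner_scaleR_right)+
    then show ?thesis using YL(1) n(2) by (simp add: algebra_simps)
  qed
  obtain e where e: "e \<in> {0, 5}" "e \<noteq> k" "e \<le> 5"
  proof (cases "k = 0")
    case True then show thesis using that[of 5] by simp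
  next
    case False then show thesis using that[of 0] by simp
  qed
  have off: "X e \<notin> L" "Y e \<notin> L" using ends[OF e(1,2)] by auto
  then have nz: "(t e - t k) * d \<noteq> 0" "(s e - s k) * d' \<noteq> 0"
    using X'[OF e(3)] Y'[OF e(3)] n(2) by auto
  have same: "0 < (t e - t k) * d \<longleftrightarrow> 0 < (s e - s k) * d'"
  proof (rule ccontr)
    assume "\<not> ?thesis"
    then have "n \<bullet> X e < h \<and> h < n \<bullet> Y e \<or> n \<bullet> Y e < h \<and> h < n \<bullet> X e"
      using nz X'[OF e(3)] Y'[OF e(3)] by linarith
    then obtain z where "z \<in> closed_segment (X e) (Y e)" "n \<bullet> z = h"
      using zero_on_segment by (metis closed_segment_commute)
    then show False using ends[OF e(1,2)] n(2) by auto
  qed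
  have "(0 < t e - t k \<longleftrightarrow> 0 < s e - s k) \<and> (t e - t k < 0 \<longleftrightarrow> s e - s k < 0)"
    using t(2)[of e k] t(2)[of k e] s(2)[of e k] s(2)[of k e] e k by (cases e k rule: linorder_cases) auto
  then have dd: "0 < d \<and> 0 < d' \<or> d < 0 \<and> d' < 0"
    using same nz by (auto simp: zero_less_mult_iff)
  have side: "k < a \<longrightarrow> 0 < t a - t k \<and> 0 < s a - s k" "a < k \<longrightarrow> t a - t k < 0 \<and> s a - s k < 0"
    if "a \<le> 5" for a using t(2) s(2) that k by auto
  show ?thesis
  proof (cases "0 < d")
    case True
    then have "0 < d'" using dd by simp
    have "(k < a \<longrightarrow> h < n \<bullet> X a \<and> h < n \<bullet> Y a) \<and> (a < k \<longrightarrow> n \<bullet> X a < h \<and> n \<bullet> Y a < h)" if "a \<le> 5" for a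
      using side[OF that] X'[OF that] Y'[OF that] True \<open>0 < d'\<close> mult_pos_pos mult_neg_pos
      by (metis diff_gt_0_iff_gt diff_less_0_iff_less)
    then show ?thesis using n by blast
  next
    case False
    then have "d < 0" "d' < 0" using dd by auto
    have "(k < a \<longrightarrow> n \<bullet> X a < h \<and> n \<bullet> Y a < h) \<and> (a < k \<longrightarrow> h < n \<bullet> X a \<and> h < n \<bullet> Y a)" if "a \<le> 5" for a
      using side[OF that] X'[OF that] Y'[OF that] \<open>d < 0\<close> \<open>d' < 0\<close> mult_pos_neg mult_neg_neg
      by (metis diff_gt_0_iff_gt diff_less_0_iff_less)
    then show ?thesis using n by (intro exI[of _ "-n"] exI[of _ "-h"]) auto
  qed
qed

text \<open>By the intermediate value argument line \<open>b\<close> crosses the chord, and it can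
  do so only at the single common point. For \<open>b = 0\<close> and \<open>b = 5\<close> this is
  an end of the chord.\<close>

lemma point_on_chord:
  fixes b :: nat
  assumes "b \<le> 5"
    and l: "l a \<inter> m b = {P a b}" "l a = {x. na \<bullet> x = ha}" "m b = {x. nb \<bullet> x = hb}"
    and on: "P a 0 \<in> l a" "P a 5 \<in> l a"
    and b: "0 < b \<Longrightarrow> nb \<bullet> P a 0 < hb" "b < 5 \<Longrightarrow> hb < nb \<bullet> P a 5"
  shows "P a b \<in> closed_segment (P a 0) (P a 5)"
proof (cases "0 < b \<and> b < 5")
  case True
  then obtain z where z: "z \<in> closed_segment (P a 0) (P a 5)" "nb \<bullet> z = hb"
    using zero_on_segment b by metis
  have "z \<in> l a" using segment_halfspace(3)[OF z(1)] on l(2) by simp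
  then have "z = P a b" using z(2) l by auto
  then show ?thesis using z(1) by simp
next
  case False
  then have "b = 0 \<or> b = 5" using assms by linarith
  then show ?thesis by auto
qed

text \<open>All normals point towards increasing indices. The inequalities hold first on the four
  sides of the large quadrilateral and extend to inner grid points by convexity along the
  chords.\<close>

lemma grid_normals:
  assumes "grid_cut l m P"
  obtains n n' h h' where
    "\<And>i. i \<le> 5 \<Longrightarrow> norm (n i) = 1" "\<And>i. i \<le> 5 \<Longrightarrow> norm (n' i) = 1"
    "\<And>a b. a \<le> 5 \<Longrightarrow> b \<le> 5 \<Longrightarrow> n a \<bullet> P a b = h a"
    "\<And>i a b. i < a \<Longrightarrow> a \<le> 5 \<Longrightarrow> b \<le> 5 \<Longrightarrow> h i < n i \<bullet> P a b"
    "\<And>i a b. a < i \<Longrightarrow> i \<le> 5 \<Longrightarrow> b \<le> 5 \<Longrightarrow> n i \<bullet> P a b < h i"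
    "\<And>a b. a \<le> 5 \<Longrightarrow> b \<le> 5 \<Longrightarrow> n' b \<bullet> P a b = h' b"
    "\<And>i a b. i < b \<Longrightarrow> a \<le> 5 \<Longrightarrow> b \<le> 5 \<Longrightarrow> h' i < n' i \<bullet> P a b"
    "\<And>i a b. b < i \<Longrightarrow> i \<le> 5 \<Longrightarrow> a \<le> 5 \<Longrightarrow> n' i \<bullet> P a b < h' i"
proof -
  let ?R = "quad_region (P 0 0) (P 0 5) (P 5 5) (P 5 0)"
  have lines: "is_line (l i)" "is_line (m i)" if "i \<le> 5" for i
    using assms that by (auto simp: grid_cut_def)
  have P: "l i \<inter> m j = {P i j}" if "i \<le> 5" "j \<le> 5" for i j
    using assms that by (auto simp: grid_cut_def)
  have ord: "in_order (\<lambda>i. P i 0)" "in_order (\<lambda>i. P i 5)" "in_order (\<lambda>j. P 0 j)" "in_order (\<lambda>j. P 5 j)"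
    using assms by (auto simp: grid_cut_def)
  have "l i \<inter> l k \<inter> ?R = {} \<and> m i \<inter> m k \<inter> ?R = {}" if "i < k" "k \<le> 5" for i k
    using assms that unfolding grid_cut_def by blast
  then have sep: "l i \<inter> l k \<inter> ?R = {}" "m i \<inter> m k \<inter> ?R = {}" if "i \<noteq> k" "i \<le> 5" "k \<le> 5" for i k
    using that by (metis inf_commute nat_neq_iff)+
  have mem: "P i j \<in> l i" "P i j \<in> m j" if "i \<le> 5" "j \<le> 5" for i j using P[OF that] by auto
  have same: "P a j = P k j" if "P a j \<in> l k" "a \<le> 5" "j \<le> 5" "k \<le> 5" for a j k
    using P[of k j] mem[of a j] that by blast
  have same': "P i a = P i k" if "P i a \<in> m k" "a \<le> 5" "i \<le> 5" "k \<le> 5" for a i k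
    using P[of i k] mem[of i a] that by blast
  have aff: "closed_segment x y \<subseteq> L" if "is_line L" "x \<in> L" "y \<in> L" for x y L
    using that by (simp add: is_line_def affine_imp_convex closed_segment_subset)
  have "\<exists>n h. norm n = 1 \<and> l k = {x. n \<bullet> x = h} \<and>
    (\<forall>a\<le>5. (k < a \<longrightarrow> h < n \<bullet> P a 0 \<and> h < n \<bullet> P a 5) \<and> (a < k \<longrightarrow> n \<bullet> P a 0 < h \<and> n \<bullet> P a 5 < h))"
    if k: "k \<le> 5" for k
  proof (rule oriented_normal[OF lines(1)[OF k] ord(1,2) k])
    \<comment> \<open>The segment lies on \<open>l e\<close> and in the region, where
      \<open>l e\<close> and \<open>l k\<close> are disjoint.\<close>
    show "closed_segment (P e 0) (P e 5) \<inter> l k = {}" if e: "e \<in> {0, 5}" "e \<noteq> k" for e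
    proof -
      have "closed_segment (P e 0) (P e 5) \<subseteq> l e" using e by (intro aff lines mem) auto
      moreover have "closed_segment (P e 0) (P e 5) \<subseteq> ?R"
        using e by (auto simp: quad_region_def quad_boundary_def closed_segment_commute)
      ultimately show ?thesis using sep(1)[of e k] e k by auto
    qed
  qed (use same mem k in auto)
  then obtain n h where n: "\<And>k. k \<le> 5 \<Longrightarrow> norm (n k) = 1 \<and> l k = {x. n k \<bullet> x = h k} \<and>
    (\<forall>a\<le>5. (k < a \<longrightarrow> h k < n k \<bullet> P a 0 \<and> h k < n k \<bullet> P a 5) \<and> (a < k \<longrightarrow> n k \<bullet> P a 0 < h k \<and> n k \<bullet> P a 5 < h k))"
    by metis
  have "\<exists>n h. norm n = 1 \<and> m k = {x. n \<bullet> x = h} \<and>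
    (\<forall>a\<le>5. (k < a \<longrightarrow> h < n \<bullet> P 0 a \<and> h < n \<bullet> P 5 a) \<and> (a < k \<longrightarrow> n \<bullet> P 0 a < h \<and> n \<bullet> P 5 a < h))"
    if k: "k \<le> 5" for k
  proof (rule oriented_normal[OF lines(2)[OF k] ord(3,4) k])
    show "closed_segment (P 0 e) (P 5 e) \<inter> m k = {}" if e: "e \<in> {0, 5}" "e \<noteq> k" for e
    proof -
      have "closed_segment (P 0 e) (P 5 e) \<subseteq> m e" using e by (intro aff lines mem) auto
      moreover have "closed_segment (P 0 e) (P 5 e) \<subseteq> ?R"
        using e by (auto simp: quad_region_def quad_boundary_def closed_segment_commute)
      ultimately show ?thesis using sep(2)[of e k] e k by auto
    qed
  qed (use same' mem k in auto)
  then obtain n' h' where n': "\<And>k. k \<le> 5 \<Longrightarrow> norm (n' k) = 1 \<and> m k = {x. n' k \<bullet> x = h' k} \<and>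
    (\<forall>a\<le>5. (k < a \<longrightarrow> h' k < n' k \<bullet> P 0 a \<and> h' k < n' k \<bullet> P 5 a) \<and> (a < k \<longrightarrow> n' k \<bullet> P 0 a < h' k \<and> n' k \<bullet> P 5 a < h' k))"
    by metis
  have edge: "P i j \<in> closed_segment (P 0 j) (P 5 j)" "P j i \<in> closed_segment (P j 0) (P j 5)"
    if "i \<le> 5" "j \<in> {0, 5}" for i j
  proof -
    have "i = 0 \<or> i = 5 \<or> (0 < i \<and> i < 5)" using that(1) by linarith
    then show "P i j \<in> closed_segment (P 0 j) (P 5 j)" "P j i \<in> closed_segment (P j 0) (P j 5)"
      using ord that by (auto simp: in_order_def open_segment_def)
  qed
  have row: "P a b \<in> closed_segment (P a 0) (P a 5)" if ab: "a \<le> 5" "b \<le> 5" for a b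
  proof (rule point_on_chord[where l = l and m = m and na = "n a" and ha = "h a" and nb = "n' b" and hb = "h' b"])
    show "n' b \<bullet> P a 0 < h' b" if "0 < b"
      using segment_halfspace(2)[OF edge(1)[of a 0]] n'[of b] that ab by simp
    show "h' b < n' b \<bullet> P a 5" if "b < 5"
      using segment_halfspace(1)[OF edge(1)[of a 5]] n'[of b] that ab by simp
  qed (use ab P n n' mem in auto)
  have column: "P a b \<in> closed_segment (P 0 b) (P 5 b)" if ab: "a \<le> 5" "b \<le> 5" for a b
  proof (rule point_on_chord[where P = "\<lambda>i j. P j i" and l = m and m = l and na = "n' b" and ha = "h' b" and nb = "n a" and hb = "h a"])
    show "n a \<bullet> P 0 b < h a" if "0 < a"
      using segment_halfspace(2)[OF edge(2)[of b 0]] n[of a] that ab by simp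
    show "h a < n a \<bullet> P 5 b" if "a < 5"
      using segment_halfspace(1)[OF edge(2)[of b 5]] n[of a] that ab by simp
    show "m b \<inter> l a = {P a b}" using P ab by auto
  qed (use ab P n n' mem in auto)
  show thesis
  proof (rule that)
    show "norm (n i) = 1" "norm (n' i) = 1" if "i \<le> 5" for i using n n' that by auto
    show "n a \<bullet> P a b = h a" "n' b \<bullet> P a b = h' b" if "a \<le> 5" "b \<le> 5" for a b
      using n[of a] n'[of b] mem that by auto
    show "h i < n i \<bullet> P a b" if "i < a" "a \<le> 5" "b \<le> 5" for i a b
      using segment_halfspace(1)[OF row[of a b]] n[of i] that by auto
    show "n i \<bullet> P a b < h i" if "a < i" "i \<le> 5" "b \<le> 5" for i a b
      using segment_halfspace(2)[OF row[of a b]] n[of i] that by auto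
    show "h' i < n' i \<bullet> P a b" if "i < b" "a \<le> 5" "b \<le> 5" for i a b
      using segment_halfspace(1)[OF column[of a b]] n'[of i] that by auto
    show "n' i \<bullet> P a b < h' i" if "b < i" "i \<le> 5" "a \<le> 5" for i a b
      using segment_halfspace(2)[OF column[of a b]] n'[of i] that by auto
  qed
qed

section \<open>From the grid to oriented circles and back\<close>

lemma convex_hull_halfspace:
  fixes n c :: "'a::real_inner"
  assumes "c \<in> convex hull S"
  shows "\<forall>x\<in>S. h \<le> n \<bullet> x \<Longrightarrow> h \<le> n \<bullet> c" "\<forall>x\<in>S. n \<bullet> x \<le> h \<Longrightarrow> n \<bullet> c \<le> h"
    "\<forall>x\<in>S. h < n \<bullet> x \<Longrightarrow> h < n \<bullet> c" "\<forall>x\<in>S. n \<bullet> x < h \<Longrightarrow> n \<bullet> c < h"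
proof -
  have sub: "c \<in> T" if "S \<subseteq> T" "convex T" for T using that assms hull_minimal by blast
  show "\<forall>x\<in>S. h \<le> n \<bullet> x \<Longrightarrow> h \<le> n \<bullet> c"
    using sub[of "{v. h \<le> n \<bullet> v}"] convex_halfspace_ge[of h n] by auto
  show "\<forall>x\<in>S. n \<bullet> x \<le> h \<Longrightarrow> n \<bullet> c \<le> h"
    using sub[of "{v. n \<bullet> v \<le> h}"] convex_halfspace_le[of n h] by auto
  show "\<forall>x\<in>S. h < n \<bullet> x \<Longrightarrow> h < n \<bullet> c"
    using sub[of "{v. h < n \<bullet> v}"] convex_halfspace_gt[of h n] by auto
  show "\<forall>x\<in>S. n \<bullet> x < h \<Longrightarrow> n \<bullet> c < h"
    using sub[of "{v. n \<bullet> v < h}"] convex_halfspace_lt[of n h] by auto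
qed

theorem theorem3p3:
  fixes l m :: "nat \<Rightarrow> (real ^ 2) set"
    and P :: "nat \<Rightarrow> nat \<Rightarrow> real ^ 2"
    and a b :: nat
  assumes "grid_cut l m P"
    and "a \<in> {0, 4}" and "b \<in> {0, 4}"
    and "\<And>i j. i \<le> 4 \<Longrightarrow> j \<le> 4 \<Longrightarrow> even (i + j) \<Longrightarrow> (i, j) \<noteq> (a, b) \<Longrightarrow> cell_circumscribed P i j"
  shows "cell_circumscribed P a b"
proof -
  obtain n n' h h' where unit: "\<And>i. i \<le> 5 \<Longrightarrow> norm (n i) = 1" "\<And>i. i \<le> 5 \<Longrightarrow> norm (n' i) = 1"
    and on: "\<And>a b. a \<le> 5 \<Longrightarrow> b \<le> 5 \<Longrightarrow> n a \<bullet> P a b = h a"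
    and above: "\<And>i a b. i < a \<Longrightarrow> a \<le> 5 \<Longrightarrow> b \<le> 5 \<Longrightarrow> h i < n i \<bullet> P a b"
    and below: "\<And>i a b. a < i \<Longrightarrow> i \<le> 5 \<Longrightarrow> b \<le> 5 \<Longrightarrow> n i \<bullet> P a b < h i"
    and on': "\<And>a b. a \<le> 5 \<Longrightarrow> b \<le> 5 \<Longrightarrow> n' b \<bullet> P a b = h' b"
    and above': "\<And>i a b. i < b \<Longrightarrow> a \<le> 5 \<Longrightarrow> b \<le> 5 \<Longrightarrow> h' i < n' i \<bullet> P a b"
    and below': "\<And>i a b. b < i \<Longrightarrow> i \<le> 5 \<Longrightarrow> a \<le> 5 \<Longrightarrow> n' i \<bullet> P a b < h' i"
    by (rule grid_normals[OF assms(1)]) blast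
  define black where "black i j \<longleftrightarrow> i \<le> 4 \<and> j \<le> 4 \<and> even (i + j) \<and> (i, j) \<noteq> (a, b)" for i j
  define incircle where "incircle i j c r \<longleftrightarrow> 0 < r \<and>
      n i \<bullet> c - h i = r \<and> n (Suc i) \<bullet> c - h (Suc i) = - r \<and>
      n' j \<bullet> c - h' j = r \<and> n' (Suc j) \<bullet> c - h' (Suc j) = - r \<and>
      (\<forall>k<i. 0 < n k \<bullet> c - h k) \<and> (\<forall>k\<le>5. Suc i < k \<longrightarrow> n k \<bullet> c - h k < 0) \<and>
      (\<forall>k<j. 0 < n' k \<bullet> c - h' k) \<and> (\<forall>k\<le>5. Suc j < k \<longrightarrow> n' k \<bullet> c - h' k < 0)" for i j c r
  have "\<exists>c r. incircle i j c r" if ij: "black i j" for i j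
  proof -
    have le: "i \<le> 4" "j \<le> 4" using ij by (simp_all add: black_def)
    have circ: "cell_circumscribed P i j" using assms(4) ij by (simp add: black_def)
    obtain c r where r: "0 < r"
      and c: "c \<in> convex hull {P i j, P i (Suc j), P (Suc i) (Suc j), P (Suc i) j}"
      and t: "touches_side c r (P i j) (P i (Suc j))" "touches_side c r (P i (Suc j)) (P (Suc i) (Suc j))"
        "touches_side c r (P (Suc i) (Suc j)) (P (Suc i) j)" "touches_side c r (P (Suc i) j) (P i j)"
      by (rule circumscribedD[OF circ[unfolded cell_circumscribed_def]]) blast
    note sgn = above above' below below' on on'
    have ne: "P i k \<noteq> P (Suc i) k'" "P k j \<noteq> P k' (Suc j)" if "k \<le> 5" "k' \<le> 5" for k k'
      using above[of i "Suc i" k'] on[of i k] above'[of j "Suc j" k'] on'[of k j] le that by force+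
    \<comment> \<open>Tangency determines the distances up to sign; the centre lying in the convex
      hull of the cell then fixes the signs.\<close>
    have abs: "\<bar>n i \<bullet> c - h i\<bar> = r" "\<bar>n' (Suc j) \<bullet> c - h' (Suc j)\<bar> = r"
      "\<bar>n (Suc i) \<bullet> c - h (Suc i)\<bar> = r" "\<bar>n' j \<bullet> c - h' j\<bar> = r"
      using le r ne ne[symmetric] unit on on'
      by (intro touches_sideD[OF t(1)] touches_sideD[OF t(2)] touches_sideD[OF t(3)] touches_sideD[OF t(4)]; simp)+
    have "h i \<le> n i \<bullet> c" "h' j \<le> n' j \<bullet> c"
      by (rule convex_hull_halfspace(1)[OF c]; use le sgn in \<open>auto simp: less_imp_le\<close>)+
    moreover have "n (Suc i) \<bullet> c \<le> h (Suc i)" "n' (Suc j) \<bullet> c \<le> h' (Suc j)"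
      by (rule convex_hull_halfspace(2)[OF c]; use le sgn in \<open>auto simp: less_imp_le\<close>)+
    moreover have "h k < n k \<bullet> c" if "k < i" for k
      by (rule convex_hull_halfspace(3)[OF c]) (use le sgn that in auto)
    moreover have "h' k < n' k \<bullet> c" if "k < j" for k
      by (rule convex_hull_halfspace(3)[OF c]) (use le sgn that in auto)
    moreover have "n k \<bullet> c < h k" if "k \<le> 5" "Suc i < k" for k
      by (rule convex_hull_halfspace(4)[OF c]) (use le sgn that in auto)
    moreover have "n' k \<bullet> c < h' k" if "k \<le> 5" "Suc j < k" for k
      by (rule convex_hull_halfspace(4)[OF c]) (use le sgn that in auto)
    ultimately have "incircle i j c r"
      unfolding incircle_def using r abs by auto
    then show ?thesis by blast
  qed
  then obtain c r where cr: "\<And>i j. black i j \<Longrightarrow> incircle i j (c i j) (r i j)" by metis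
  \<comment> \<open>Opposite normals would require both \<open>h i < - h (Suc i)\<close> and
    \<open>- h (Suc i) < h i\<close>.\<close>
  have adj: "n i \<noteq> - n (Suc i)" "n' i \<noteq> - n' (Suc i)" if "i \<le> 4" for i
    using above[of i "Suc i" 0] below[of i "Suc i" 0] on[of i 0] on[of "Suc i" 0]
      above'[of i "Suc i" 0] below'[of i "Suc i" 0] on'[of 0 i] on'[of 0 "Suc i"] that by auto
  have trans: "n i \<noteq> n' j" "n i \<noteq> - n' j" if "i \<le> 5" "j \<le> 5" for i j
  proof -
    \<comment> \<open>Any index other than \<open>j\<close> works: \<open>P i k\<close> and
      \<open>P i j\<close> both lie on line \<open>i\<close>, but only the latter lies on line
      \<open>j\<close> of the other family.\<close>
    define k where "k = (if j = 0 then 1 else 0 :: nat)"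
    have "n' j \<bullet> P i k \<noteq> h' j" "k \<le> 5"
      using above'[of j k i] below'[of k j i] that by (auto simp: k_def)
    then show "n i \<noteq> n' j" "n i \<noteq> - n' j"
      using on[of i k] on[of i j] on'[of i j] that by auto
  qed
  have "\<exists>p s. n a \<bullet> p - h a = s \<and> n (Suc a) \<bullet> p - h (Suc a) = - s \<and>
               n' b \<bullet> p - h' b = s \<and> n' (Suc b) \<bullet> p - h' (Suc b) = - s"
  proof (rule corner_circle[where n = n and n' = n' and h = h and h' = h'
        and black = black and c = c and r = r])
    show "0 < r i j" "n i \<bullet> c i j - h i = r i j" "n (Suc i) \<bullet> c i j - h (Suc i) = - r i j"
      "n' j \<bullet> c i j - h' j = r i j" "n' (Suc j) \<bullet> c i j - h' (Suc j) = - r i j"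
      if "black i j" for i j
      using cr[OF that] by (simp_all add: incircle_def)
    show "0 < n k \<bullet> c i j - h k" if "black i j" "k < i" for i j k
      using cr[OF that(1)] that(2) by (simp add: incircle_def)
    show "n k \<bullet> c i j - h k < 0" if "black i j" "Suc i < k" "k \<le> 5" for i j k
      using cr[OF that(1)] that(2,3) by (simp add: incircle_def)
    show "0 < n' k \<bullet> c i j - h' k" if "black i j" "k < j" for i j k
      using cr[OF that(1)] that(2) by (simp add: incircle_def)
    show "n' k \<bullet> c i j - h' k < 0" if "black i j" "Suc j < k" "k \<le> 5" for i j k
      using cr[OF that(1)] that(2,3) by (simp add: incircle_def)
  qed (fact unit adj trans assms(2,3) black_def)+
  then obtain p s where ps: "n a \<bullet> p - h a = s" "n (Suc a) \<bullet> p - h (Suc a) = - s"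
      "n' b \<bullet> p - h' b = s" "n' (Suc b) \<bullet> p - h' (Suc b) = - s" by blast
  have ab: "a \<le> 4" "b \<le> 4" using assms(2,3) by auto
  show ?thesis
    unfolding cell_circumscribed_def
    \<comment> \<open>The signs turn the normals of the two lines with larger index inwards, and
      with them the four signed distances all equal \<open>s\<close>.\<close>
    by (rule circumscribedI[where ?n1.0 = "n a" and ?h1.0 = "h a"
          and ?n2.0 = "- n' (Suc b)" and ?h2.0 = "- h' (Suc b)"
          and ?n3.0 = "- n (Suc a)" and ?h3.0 = "- h (Suc a)"
          and ?n4.0 = "n' b" and ?h4.0 = "h' b" and p = p and s = s])
      (use ab ps unit on on' above above' below below' in auto)
qed

end
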